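(* Let $L$ be a $3$-Lie algebra over a field $\mathbb{k}$, let $X=\mathbb{k}\oplus L$ with comultiplication $\Delta$ and ternary operation $T$ as in the context, and let $R: X^{\otimes 2}\otimes X^{\otimes 2}\to X^{\otimes 2}\otimes X^{\otimes 2}$ be the linear map $$R(x\otimes y\otimes z\otimes w)= z^{(1)}\otimes w^{(1)}\otimes T(x\otimes z^{(2)}\otimes w^{(2)})\otimes T(y\otimes z^{(3)}\otimes w^{(3)}),\qquad x,y,z,w\in X.$$ Then $R$ is a Yang-Baxter operator.
   Context: A $3$-Lie algebra over $\mathbb{k}$ is a $\mathbb{k}$-vector space $L$ with a trilinear map $[\cdot,\cdot,\cdot]:L^{\times 3}\to L$ such that $[x_1,x_2,x_3]=\mathrm{sgn}(\sigma)[x_{\sigma(1)},x_{\sigma(2)},x_{\sigma(3)}]$ for every permutation $\sigma$ of $\{1,2,3\}$, and $$[[x_1,x_2,x_3],x_4,x_5]=[[x_1,x_4,x_5],x_2,x_3]+[x_1,[x_2,x_4,x_5],x_3]+[x_1,x_2,[x_3,x_4,x_5]]$$ for all $x_i\in L$. Elements of $X=\mathbb{k}\oplus L$ are written as pairs $(a,x)$, $a\in\mathbb{k}$, $x\in L$; tensor products are over $\mathbb{k}$. The linear maps are $$\Delta(a,x)=(a,x)\otimes(1,0)+(1,0)\otimes(0,x),\qquad T((a,x)\otimes(b,y)\otimes(c,z))=(abc,\ bcx+[x,y,z]).$$ Sweedler notation $(\mathbf 1\otimes\Delta)\Delta(z)=z^{(1)}\otimes z^{(2)}\otimes z^{(3)}$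 (sum understood) is used. For a vector space $V$, a Yang-Baxter operator is an invertible linear map $R:V\otimes V\to V\otimes V$ with $(R\otimes \mathbf 1)(\mathbf 1\otimes R)(R\otimes \mathbf 1)=(\mathbf 1\otimes R)(R\otimes \mathbf 1)(\mathbf 1\otimes R)$; here $V=X^{\otimes 2}$ and $\mathbf 1$ is the identity of $V$. *)

theory Defs
  imports
    "HOL-Algebra.AbelCoset"
    "Jordan_Normal_Form.Missing_VectorSpace"
    "HOL-Combinatorics.Permutations"
begin

section \<open>Tensor products of vector spaces\<close>

definition regular_module :: "('k, 'm) ring_scheme \<Rightarrow> ('k, 'k) module" where
  "regular_module K =
    \<lparr>carrier = carrier K, mult = mult K, one = one K, zero = zero K, add = add K, smult = mult K\<rparr>"

definition free_module :: "('k, 'm) ring_scheme \<Rightarrow> 's set \<Rightarrow> ('k, 's \<Rightarrow> 'k) module" where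
  "free_module K S =
    (ring.func_space K S)
      \<lparr>carrier := {\<phi> \<in> S \<rightarrow>\<^sub>E carrier K. finite {s \<in> S. \<phi> s \<noteq> \<zero>\<^bsub>K\<^esub>}}\<rparr>"

definition free_gen :: "('k, 'm) ring_scheme \<Rightarrow> 's set \<Rightarrow> 's \<Rightarrow> ('s \<Rightarrow> 'k)" where
  "free_gen K S s = (\<lambda>t\<in>S. if t = s then \<one>\<^bsub>K\<^esub> else \<zero>\<^bsub>K\<^esub>)"

text \<open>The fields \<open>mult\<close> and \<open>one\<close> of a module record carry no meaning for a module.\<close>

definition quotient_module :: "('k, 'a, 'm) module_scheme \<Rightarrow> 'a set \<Rightarrow> ('k, 'a set) module" where
  "quotient_module M N =
    \<lparr>carrier = a_rcosets\<^bsub>M\<^esub> N, mult = (\<lambda>_ _. N), one = N, zero = N,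
     add = (\<lambda>A B. A <+>\<^bsub>M\<^esub> B), smult = (\<lambda>c A. \<Union>x\<in>A. N +>\<^bsub>M\<^esub> (c \<odot>\<^bsub>M\<^esub> x))\<rparr>"

abbreviation tensor_free ::
  "('k, 'm) ring_scheme \<Rightarrow> ('k, 'a, 'p) module_scheme \<Rightarrow> ('k, 'b, 'q) module_scheme \<Rightarrow>
   ('k, 'a \<times> 'b \<Rightarrow> 'k) module" where
  "tensor_free K M N \<equiv> free_module K (carrier M \<times> carrier N)"

abbreviation tensor_gen ::
  "('k, 'm) ring_scheme \<Rightarrow> ('k, 'a, 'p) module_scheme \<Rightarrow> ('k, 'b, 'q) module_scheme \<Rightarrow>
   'a \<times> 'b \<Rightarrow> 'a \<times> 'b \<Rightarrow> 'k" where
  "tensor_gen K M N \<equiv> free_gen K (carrier M \<times> carrier N)"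

definition tensor_relators ::
  "('k, 'm) ring_scheme \<Rightarrow> ('k, 'a, 'p) module_scheme \<Rightarrow> ('k, 'b, 'q) module_scheme \<Rightarrow>
   ('a \<times> 'b \<Rightarrow> 'k) set" where
  "tensor_relators K M N =
    (let F = tensor_free K M N; \<delta> = tensor_gen K M N in
       {\<delta> (x \<oplus>\<^bsub>M\<^esub> x', y) \<ominus>\<^bsub>F\<^esub> (\<delta> (x, y) \<oplus>\<^bsub>F\<^esub> \<delta> (x', y)) | x x' y.
          x \<in> carrier M \<and> x' \<in> carrier M \<and> y \<in> carrier N} \<union>
       {\<delta> (x, y \<oplus>\<^bsub>N\<^esub> y') \<ominus>\<^bsub>F\<^esub> (\<delta> (x, y) \<oplus>\<^bsub>F\<^esub> \<delta> (x, y')) | x y y'.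
          x \<in> carrier M \<and> y \<in> carrier N \<and> y' \<in> carrier N} \<union>
       {\<delta> (c \<odot>\<^bsub>M\<^esub> x, y) \<ominus>\<^bsub>F\<^esub> c \<odot>\<^bsub>F\<^esub> \<delta> (x, y) | c x y.
          c \<in> carrier K \<and> x \<in> carrier M \<and> y \<in> carrier N} \<union>
       {\<delta> (x, c \<odot>\<^bsub>N\<^esub> y) \<ominus>\<^bsub>F\<^esub> c \<odot>\<^bsub>F\<^esub> \<delta> (x, y) | c x y.
          c \<in> carrier K \<and> x \<in> carrier M \<and> y \<in> carrier N})"

definition tensor_null ::
  "('k, 'm) ring_scheme \<Rightarrow> ('k, 'a, 'p) module_scheme \<Rightarrow> ('k, 'b, 'q) module_scheme \<Rightarrow>
   ('a \<times> 'b \<Rightarrow> 'k) set" where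
  "tensor_null K M N =
    module.span K (tensor_free K M N) (tensor_relators K M N)"

definition tensor ::
  "('k, 'm) ring_scheme \<Rightarrow> ('k, 'a, 'p) module_scheme \<Rightarrow> ('k, 'b, 'q) module_scheme \<Rightarrow>
   ('k, ('a \<times> 'b \<Rightarrow> 'k) set) module" where
  "tensor K M N = quotient_module (tensor_free K M N) (tensor_null K M N)"

definition pure_tensor ::
  "('k, 'm) ring_scheme \<Rightarrow> ('k, 'a, 'p) module_scheme \<Rightarrow> ('k, 'b, 'q) module_scheme \<Rightarrow>
   'a \<Rightarrow> 'b \<Rightarrow> ('a \<times> 'b \<Rightarrow> 'k) set" where
  "pure_tensor K M N x y =
    tensor_null K M N +>\<^bsub>tensor_free K M N\<^esub>
      tensor_gen K M N (x, y)"

text \<open>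
  The linear map on the free module sending the generator \<open>(x, y)\<close> to \<open>b x y\<close>.
\<close>

definition tensor_eval ::
  "('k, 'm) ring_scheme \<Rightarrow> ('k, 'a, 'p) module_scheme \<Rightarrow> ('k, 'b, 'q) module_scheme \<Rightarrow>
   ('k, 'c, 'r) module_scheme \<Rightarrow> ('a \<Rightarrow> 'b \<Rightarrow> 'c) \<Rightarrow> ('a \<times> 'b \<Rightarrow> 'k) \<Rightarrow> 'c" where
  "tensor_eval K M N P b \<phi> =
    (\<Oplus>\<^bsub>P\<^esub>p\<in>{p \<in> carrier M \<times> carrier N. \<phi> p \<noteq> \<zero>\<^bsub>K\<^esub>}. \<phi> p \<odot>\<^bsub>P\<^esub> b (fst p) (snd p))"

text \<open>
  The map on the tensor product of \<open>M\<close> and \<open>N\<close> induced by \<open>b\<close>.  For bilinear \<open>b\<close> the evaluation is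
  constant on every coset \<open>t\<close>, and the result is the linear map sending \<open>x \<otimes> y\<close> to \<open>b x y\<close>; see
  \<open>tensor_lift_hom\<close> and \<open>tensor_lift_pure\<close> below.
\<close>

definition tensor_lift ::
  "('k, 'm) ring_scheme \<Rightarrow> ('k, 'a, 'p) module_scheme \<Rightarrow> ('k, 'b, 'q) module_scheme \<Rightarrow>
   ('k, 'c, 'r) module_scheme \<Rightarrow> ('a \<Rightarrow> 'b \<Rightarrow> 'c) \<Rightarrow> ('a \<times> 'b \<Rightarrow> 'k) set \<Rightarrow> 'c" where
  "tensor_lift K M N P b t = the_elem (tensor_eval K M N P b ` t)"

definition bilinear_map ::
  "('k, 'm) ring_scheme \<Rightarrow> ('k, 'a, 'p) module_scheme \<Rightarrow> ('k, 'b, 'q) module_scheme \<Rightarrow>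
   ('k, 'c, 'r) module_scheme \<Rightarrow> ('a \<Rightarrow> 'b \<Rightarrow> 'c) \<Rightarrow> bool" where
  "bilinear_map K M N P b \<longleftrightarrow>
    (\<forall>y\<in>carrier N. (\<lambda>x. b x y) \<in> module_hom K M P) \<and> (\<forall>x\<in>carrier M. b x \<in> module_hom K N P)"

definition trilinear_map ::
  "('k, 'm) ring_scheme \<Rightarrow> ('k, 'a, 'p) module_scheme \<Rightarrow> ('k, 'b, 'q) module_scheme \<Rightarrow>
   ('k, 'c, 'r) module_scheme \<Rightarrow> ('k, 'd, 's) module_scheme \<Rightarrow> ('a \<Rightarrow> 'b \<Rightarrow> 'c \<Rightarrow> 'd) \<Rightarrow> bool"
where
  "trilinear_map K A B C P b \<longleftrightarrow>
    (\<forall>y\<in>carrier B. \<forall>z\<in>carrier C. (\<lambda>x. b x y z) \<in> module_hom K A P) \<and>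
    (\<forall>x\<in>carrier A. bilinear_map K B C P (b x))"

lemma submodule_imp_subgroup:
  fixes M (structure)
  assumes "submodule K N M"
  shows "subgroup N (add_monoid M)"
proof -
  interpret N: submodule K N M by fact
  interpret module K M by (rule N.module)
  show ?thesis
  proof (rule add.subgroupI)
    fix a assume a: "a \<in> N"
    then have "(\<ominus>\<^bsub>K\<^esub> \<one>\<^bsub>K\<^esub>) \<odot> a \<in> N" by simp
    moreover have "(\<ominus>\<^bsub>K\<^esub> \<one>\<^bsub>K\<^esub>) \<odot> a = \<ominus> a"
      using a N.subset by (subst smult_l_minus) auto
    ultimately show "\<ominus> a \<in> N" by simp
  next
    show "N \<noteq> {}" using N.zero_closed by blast
  qed (use N.subset in auto)
qed

lemma submodule_coset_eq:
  fixes M (structure)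
  assumes "submodule K N M" "y \<in> carrier M" "x \<in> N +> y"
  shows "N +> x = N +> y"
proof -
  interpret module K M using assms(1) by (rule submodule.module)
  show ?thesis
    using add.repr_independence[of x N y] assms submodule_imp_subgroup[OF assms(1)]
    by (simp add: a_r_coset_def)
qed

context
  fixes K :: "('k, 'm) ring_scheme" and S :: "'s set"
  assumes K: "cring K"
begin

interpretation K: cring K by (rule K)

lemma free_module_module: "module K (free_module K S)"
proof -
  interpret FS: module K "K.func_space S" by (rule K.func_space_is_module)
  have "submodule K {\<phi> \<in> S \<rightarrow>\<^sub>E carrier K. finite {s \<in> S. \<phi> s \<noteq> \<zero>\<^bsub>K\<^esub>}} (K.func_space S)"
  proof (unfold_locales, goal_cases)
    case 1 then show ?case by (auto simp: K.func_space_def)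
  next
    case (2 v w)
    have "{s \<in> S. v s \<oplus>\<^bsub>K\<^esub> w s \<noteq> \<zero>\<^bsub>K\<^esub>} \<subseteq> {s \<in> S. v s \<noteq> \<zero>\<^bsub>K\<^esub>} \<union> {s \<in> S. w s \<noteq> \<zero>\<^bsub>K\<^esub>}"
      by auto
    from finite_subset[OF this] 2 show ?case
      by (auto simp: K.func_space_def PiE_def Pi_def cong: conj_cong)
  next
    case 3 show ?case by (auto simp: K.func_space_def cong: conj_cong)
  next
    case (4 c v)
    have "{s \<in> S. c \<otimes>\<^bsub>K\<^esub> v s \<noteq> \<zero>\<^bsub>K\<^esub>} \<subseteq> {s \<in> S. v s \<noteq> \<zero>\<^bsub>K\<^esub>}"
      using 4 by auto
    from finite_subset[OF this] 4 show ?case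
      by (auto simp: K.func_space_def PiE_def Pi_def cong: conj_cong)
  qed
  from FS.submodule_is_module[OF this] show ?thesis
    by (simp add: free_module_def)
qed

lemma free_module_sel:
  "carrier (free_module K S) = {\<phi> \<in> S \<rightarrow>\<^sub>E carrier K. finite {s \<in> S. \<phi> s \<noteq> \<zero>\<^bsub>K\<^esub>}}"
  "add (free_module K S) = (\<lambda>f g. \<lambda>s\<in>S. f s \<oplus>\<^bsub>K\<^esub> g s)"
  "smult (free_module K S) = (\<lambda>c f. \<lambda>s\<in>S. c \<otimes>\<^bsub>K\<^esub> f s)"
  "zero (free_module K S) = (\<lambda>s\<in>S. \<zero>\<^bsub>K\<^esub>)"
  by (simp_all add: free_module_def K.func_space_def)

lemma free_gen_closed: "free_gen K S s \<in> carrier (free_module K S)"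
proof -
  have "finite {t \<in> S. free_gen K S s t \<noteq> \<zero>\<^bsub>K\<^esub>}"
    by (rule finite_subset[of _ "{s}"]) (auto simp: free_gen_def split: if_splits)
  then show ?thesis by (auto simp: free_module_sel free_gen_def)
qed

end

lemma quotient_module_module:
  fixes M (structure)
  assumes "submodule K N M"
  shows "module K (quotient_module M N)"
    and "\<And>x. x \<in> carrier M \<Longrightarrow> N +> x \<in> carrier (quotient_module M N)"
    and "\<And>x y. x \<in> carrier M \<Longrightarrow> y \<in> carrier M \<Longrightarrow>
           add (quotient_module M N) (N +> x) (N +> y) = N +> (x \<oplus> y)"
    and "\<And>c x. c \<in> carrier K \<Longrightarrow> x \<in> carrier M \<Longrightarrow>
           c \<odot>\<^bsub>quotient_module M N\<^esub> (N +> x) = N +> (c \<odot> x)"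
proof -
  interpret N: submodule K N M by fact
  interpret module K M by (rule N.module)
  have sgr: "subgroup N (add_monoid M)" by (rule submodule_imp_subgroup) fact
  interpret A: abelian_subgroup N M
    by (rule abelian_subgroupI3) (auto intro: additive_subgroup.intro sgr abelian_group_axioms)
  show cl: "N +> x \<in> carrier (quotient_module M N)" if "x \<in> carrier M" for x
    using that by (auto simp: quotient_module_def A_RCOSETS_def')
  show add: "add (quotient_module M N) (N +> x) (N +> y) = N +> (x \<oplus> y)"
    if "x \<in> carrier M" "y \<in> carrier M" for x y
    using that A.a_rcos_sum by (simp add: quotient_module_def)
  show sm: "c \<odot>\<^bsub>quotient_module M N\<^esub> (N +> x) = N +> (c \<odot> x)"
    if c: "c \<in> carrier K" and x: "x \<in> carrier M" for c x
  proof -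
    have eq: "N +> (c \<odot> z) = N +> (c \<odot> x)" if z: "z \<in> N +> x" for z
    proof -
      from z obtain n where n: "n \<in> N" "z = n \<oplus> x" by (auto simp: a_r_coset_def')
      have nc: "n \<in> carrier M" using n N.subset by auto
      have "c \<odot> z = (c \<odot> n) \<oplus> (c \<odot> x)" using c x n nc by (simp add: smult_r_distr)
      then have "c \<odot> z \<in> N +> (c \<odot> x)" using c n by (auto simp: a_r_coset_def')
      then show ?thesis by (rule submodule_coset_eq[OF assms smult_closed[OF c x]])
    qed
    have "x \<in> N +> x" using x A.a_rcos_self by auto
    then have ne: "N +> x \<noteq> {}" by blast
    have "(\<Union>z\<in>N +> x. N +> (c \<odot> z)) = (\<Union>z\<in>N +> x. N +> (c \<odot> x))"
      by (rule SUP_cong[OF refl eq])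
    also have "\<dots> = N +> (c \<odot> x)" using ne by (simp del: UN_simps add: UN_constant)
    finally show ?thesis by (simp add: quotient_module_def)
  qed
  have car: "\<exists>x\<in>carrier M. A = N +> x" if "A \<in> carrier (quotient_module M N)" for A
    using that by (auto simp: quotient_module_def A_RCOSETS_def')
  have ab: "abelian_group (quotient_module M N)"
  proof (rule abelian_groupI, goal_cases)
    case (1 A B)
    then show ?case using car[of A] car[of B] by (auto simp: add cl)
  next
    case 2
    show ?case using cl[of \<zero>] N.subset by (simp add: quotient_module_def)
  next
    case (3 A B C)
    then show ?case using car[of A] car[of B] car[of C] by (auto simp: add a_assoc)
  next
    case (4 A B)
    then show ?case using car[of A] car[of B] by (auto simp: add a_comm)
  next
    case (5 A)
    then obtain x where x: "x \<in> carrier M" "A = N +> x" using car by blast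
    then show ?case using add[of \<zero> x] N.subset by (simp add: quotient_module_def)
  next
    case (6 A)
    then obtain x where x: "x \<in> carrier M" "A = N +> x" using car by blast
    then have "add (quotient_module M N) (N +> (\<ominus> x)) A = N +> \<zero>"
      by (simp add: add l_neg)
    then show ?case using x cl[of "\<ominus> x"] N.subset by (auto simp: quotient_module_def)
  qed
  show "module K (quotient_module M N)"
  proof (rule moduleI, goal_cases)
    case 1 show ?case by (rule R.is_cring)
  next
    case 2 show ?case by (rule ab)
  next
    case (3 c A)
    then show ?case using car[of A] by (auto simp: sm cl)
  next
    case (4 c d A)
    then show ?case using car[of A] by (auto simp: sm add smult_l_distr)
  next
    case (5 c A B)
    then show ?case using car[of A] car[of B] by (auto simp: sm add smult_r_distr)
  next
    case (6 c d A)
    then show ?case using car[of A] by (auto simp: sm smult_assoc1)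
  next
    case (7 A)
    then show ?case using car[of A] by (auto simp: sm)
  qed
qed

context
  fixes K :: "('k, 'm) ring_scheme"
    and M :: "('k, 'a, 'p) module_scheme" and N :: "('k, 'b, 'q) module_scheme"
  assumes M: "module K M" and N: "module K N"
begin

interpretation M: module K M by (rule M)
interpretation N: module K N by (rule N)

interpretation F: module K "tensor_free K M N" by (rule free_module_module[OF M.is_cring])

lemmas tensor_free_sel = free_module_sel[OF M.is_cring, of "carrier M \<times> carrier N"]
lemmas tensor_gen_closed [simp] = free_gen_closed[OF M.is_cring, of "carrier M \<times> carrier N"]

lemma tensor_relators_closed: "tensor_relators K M N \<subseteq> carrier (tensor_free K M N)"
  unfolding tensor_relators_def Let_def by auto

lemma tensor_null_submodule: "submodule K (tensor_null K M N) (tensor_free K M N)"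
  unfolding tensor_null_def by (rule F.span_is_submodule[OF tensor_relators_closed])

lemma tensor_module: "module K (tensor K M N)"
  unfolding tensor_def by (rule quotient_module_module(1)[OF tensor_null_submodule])

lemma tensor_relator_coset:
  assumes "u \<in> carrier (tensor_free K M N)" "v \<in> carrier (tensor_free K M N)"
    and "u \<ominus>\<^bsub>tensor_free K M N\<^esub> v \<in> tensor_relators K M N"
  shows "tensor_null K M N +>\<^bsub>tensor_free K M N\<^esub> u = tensor_null K M N +>\<^bsub>tensor_free K M N\<^esub> v"
proof -
  interpret T: submodule K "tensor_null K M N" "tensor_free K M N" by (rule tensor_null_submodule)
  have "u \<ominus>\<^bsub>tensor_free K M N\<^esub> v \<in> tensor_null K M N"
    using F.in_own_span[OF tensor_relators_closed] assms(3) by (auto simp: tensor_null_def)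
  moreover have "u = (u \<ominus>\<^bsub>tensor_free K M N\<^esub> v) \<oplus>\<^bsub>tensor_free K M N\<^esub> v"
    using assms by (simp add: F.minus_eq F.a_assoc F.l_neg)
  ultimately have "u \<in> tensor_null K M N +>\<^bsub>tensor_free K M N\<^esub> v"
    by (auto simp: a_r_coset_def')
  then show ?thesis
    by (rule submodule_coset_eq[OF tensor_null_submodule assms(2)])
qed


lemma pure_tensor_closed:
  "x \<in> carrier M \<Longrightarrow> y \<in> carrier N \<Longrightarrow> pure_tensor K M N x y \<in> carrier (tensor K M N)"
  unfolding pure_tensor_def tensor_def
  by (rule quotient_module_module(2)[OF tensor_null_submodule]) simp

lemma pure_tensor_bilinear: "bilinear_map K M N (tensor K M N) (pure_tensor K M N)"
proof -
  note q = quotient_module_module[OF tensor_null_submodule]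
  note rel = tensor_relators_def Let_def
  have "pure_tensor K M N (x \<oplus>\<^bsub>M\<^esub> x') y =
      pure_tensor K M N x y \<oplus>\<^bsub>tensor K M N\<^esub> pure_tensor K M N x' y"
    if "x \<in> carrier M" "x' \<in> carrier M" "y \<in> carrier N" for x x' y
    unfolding pure_tensor_def tensor_def q(3)[OF tensor_gen_closed tensor_gen_closed]
    by (rule tensor_relator_coset; (simp; fail)?)
      (unfold rel, rule UnI1, rule UnI1, rule UnI1, rule CollectI, intro exI conjI, rule refl, (rule that)+)
  moreover have "pure_tensor K M N x (y \<oplus>\<^bsub>N\<^esub> y') =
      pure_tensor K M N x y \<oplus>\<^bsub>tensor K M N\<^esub> pure_tensor K M N x y'"
    if "x \<in> carrier M" "y \<in> carrier N" "y' \<in> carrier N" for x y y'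
    unfolding pure_tensor_def tensor_def q(3)[OF tensor_gen_closed tensor_gen_closed]
    by (rule tensor_relator_coset; (simp; fail)?)
      (unfold rel, rule UnI1, rule UnI1, rule UnI2, rule CollectI, intro exI conjI, rule refl, (rule that)+)
  moreover have "pure_tensor K M N (c \<odot>\<^bsub>M\<^esub> x) y = c \<odot>\<^bsub>tensor K M N\<^esub> pure_tensor K M N x y"
    if "c \<in> carrier K" "x \<in> carrier M" "y \<in> carrier N" for c x y
    unfolding pure_tensor_def tensor_def q(4)[OF that(1) tensor_gen_closed]
    by (rule tensor_relator_coset; (simp add: that; fail)?)
      (unfold rel, rule UnI1, rule UnI2, rule CollectI, intro exI conjI, rule refl, (rule that)+)
  moreover have "pure_tensor K M N x (c \<odot>\<^bsub>N\<^esub> y) = c \<odot>\<^bsub>tensor K M N\<^esub> pure_tensor K M N x y"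
    if "c \<in> carrier K" "x \<in> carrier M" "y \<in> carrier N" for c x y
    unfolding pure_tensor_def tensor_def q(4)[OF that(1) tensor_gen_closed]
    by (rule tensor_relator_coset; (simp add: that; fail)?)
      (unfold rel, rule UnI2, rule CollectI, intro exI conjI, rule refl, (rule that)+)
  ultimately show ?thesis
    unfolding bilinear_map_def module_hom_def by (simp add: pure_tensor_closed)
qed

lemma tensor_free_val:
  assumes "\<phi> \<in> carrier (tensor_free K M N)" "p \<in> carrier M \<times> carrier N"
  shows "\<phi> p \<in> carrier K"
  using assms by (auto simp: tensor_free_sel)

context
  fixes P :: "('k, 'c, 'r) module_scheme" and b :: "'a \<Rightarrow> 'b \<Rightarrow> 'c"
  assumes P: "module K P" and b: "bilinear_map K M N P b"
begin

interpretation P: module K P by (rule P)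

lemma bilinear_map_closed: "x \<in> carrier M \<Longrightarrow> y \<in> carrier N \<Longrightarrow> b x y \<in> carrier P"
  using b by (auto simp: bilinear_map_def module_hom_def)

lemma tensor_term_closed:
  assumes "\<phi> \<in> carrier (tensor_free K M N)" "p \<in> carrier M \<times> carrier N"
  shows "\<phi> p \<odot>\<^bsub>P\<^esub> b (fst p) (snd p) \<in> carrier P"
  using assms by (intro P.smult_closed tensor_free_val bilinear_map_closed) auto

lemma tensor_eval_eq:
  assumes "\<phi> \<in> carrier (tensor_free K M N)" "finite A"
    and "{p \<in> carrier M \<times> carrier N. \<phi> p \<noteq> \<zero>\<^bsub>K\<^esub>} \<subseteq> A" "A \<subseteq> carrier M \<times> carrier N"
  shows "tensor_eval K M N P b \<phi> = (\<Oplus>\<^bsub>P\<^esub>p\<in>A. \<phi> p \<odot>\<^bsub>P\<^esub> b (fst p) (snd p))"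
  unfolding tensor_eval_def
proof (rule P.add.finprod_mono_neutral_cong_left[OF assms(2,3) _ refl])
  fix p assume p: "p \<in> A - {p \<in> carrier M \<times> carrier N. \<phi> p \<noteq> \<zero>\<^bsub>K\<^esub>}"
  then have "p \<in> carrier M \<times> carrier N" "\<phi> p = \<zero>\<^bsub>K\<^esub>" using assms(4) by blast+
  then show "\<phi> p \<odot>\<^bsub>P\<^esub> b (fst p) (snd p) = \<zero>\<^bsub>P\<^esub>" by (simp add: mem_Times_iff bilinear_map_closed)
next
  show "(\<lambda>p. \<phi> p \<odot>\<^bsub>P\<^esub> b (fst p) (snd p)) \<in> A \<rightarrow> carrier P"
    using assms(1,4) by (intro Pi_I tensor_term_closed) auto
qed

lemma tensor_eval_hom: "tensor_eval K M N P b \<in> module_hom K (tensor_free K M N) P"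
proof -
  let ?F = "tensor_free K M N" and ?S = "carrier M \<times> carrier N"
  let ?supp = "\<lambda>\<phi>. {p \<in> ?S. \<phi> p \<noteq> \<zero>\<^bsub>K\<^esub>}"
  let ?b = "\<lambda>p. b (fst p) (snd p)"
  have fin: "finite (?supp \<phi>)" if "\<phi> \<in> carrier ?F" for \<phi>
    using that by (simp add: tensor_free_sel)
  have bc: "?b p \<in> carrier P" if "p \<in> ?S" for p
    using that by (intro bilinear_map_closed) auto
  show ?thesis unfolding module_hom_def
  proof (intro CollectI conjI allI impI Pi_I; (elim conjE)?)
    fix \<phi> assume "\<phi> \<in> carrier ?F"
    then show "tensor_eval K M N P b \<phi> \<in> carrier P"
      unfolding tensor_eval_def by (intro P.finsum_closed Pi_I tensor_term_closed) auto
  next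
    fix \<phi> \<psi> assume h: "\<phi> \<in> carrier ?F" "\<psi> \<in> carrier ?F"
    let ?A = "?supp \<phi> \<union> ?supp \<psi>"
    have A: "finite ?A" "?A \<subseteq> ?S" using fin h by auto
    have "?supp (\<phi> \<oplus>\<^bsub>?F\<^esub> \<psi>) \<subseteq> ?A" by (auto simp: tensor_free_sel)
    then have "tensor_eval K M N P b (\<phi> \<oplus>\<^bsub>?F\<^esub> \<psi>) = (\<Oplus>\<^bsub>P\<^esub>p\<in>?A. (\<phi> \<oplus>\<^bsub>?F\<^esub> \<psi>) p \<odot>\<^bsub>P\<^esub> ?b p)"
      using A h by (intro tensor_eval_eq F.a_closed)
    also have "\<dots> = (\<Oplus>\<^bsub>P\<^esub>p\<in>?A. \<phi> p \<odot>\<^bsub>P\<^esub> ?b p \<oplus>\<^bsub>P\<^esub> \<psi> p \<odot>\<^bsub>P\<^esub> ?b p)"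
    proof (rule P.finsum_cong'[OF refl])
      show "(\<lambda>p. \<phi> p \<odot>\<^bsub>P\<^esub> ?b p \<oplus>\<^bsub>P\<^esub> \<psi> p \<odot>\<^bsub>P\<^esub> ?b p) \<in> ?A \<rightarrow> carrier P"
        using h A(2) by (intro Pi_I P.a_closed tensor_term_closed) auto
      fix p assume "p \<in> ?A"
      then have p: "p \<in> ?S" by blast
      have "(\<phi> \<oplus>\<^bsub>?F\<^esub> \<psi>) p = \<phi> p \<oplus>\<^bsub>K\<^esub> \<psi> p"
        using p by (simp only: tensor_free_sel restrict_apply if_True)
      then show "(\<phi> \<oplus>\<^bsub>?F\<^esub> \<psi>) p \<odot>\<^bsub>P\<^esub> ?b p = \<phi> p \<odot>\<^bsub>P\<^esub> ?b p \<oplus>\<^bsub>P\<^esub> \<psi> p \<odot>\<^bsub>P\<^esub> ?b p"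
        using P.smult_l_distr[OF tensor_free_val[OF h(1) p] tensor_free_val[OF h(2) p] bc[OF p]]
        by (simp only:)
    qed
    also have "\<dots> = (\<Oplus>\<^bsub>P\<^esub>p\<in>?A. \<phi> p \<odot>\<^bsub>P\<^esub> ?b p) \<oplus>\<^bsub>P\<^esub> (\<Oplus>\<^bsub>P\<^esub>p\<in>?A. \<psi> p \<odot>\<^bsub>P\<^esub> ?b p)"
      using h A(2) by (intro P.finsum_addf Pi_I tensor_term_closed) auto
    also have "\<dots> = tensor_eval K M N P b \<phi> \<oplus>\<^bsub>P\<^esub> tensor_eval K M N P b \<psi>"
      using tensor_eval_eq[OF h(1) A(1) _ A(2)] tensor_eval_eq[OF h(2) A(1) _ A(2)]
      by (simp only: Un_upper1 Un_upper2)
    finally show "tensor_eval K M N P b (\<phi> \<oplus>\<^bsub>?F\<^esub> \<psi>) =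
      tensor_eval K M N P b \<phi> \<oplus>\<^bsub>P\<^esub> tensor_eval K M N P b \<psi>" .
  next
    fix c \<phi> assume h: "c \<in> carrier K" "\<phi> \<in> carrier ?F"
    let ?A = "?supp \<phi>"
    have A: "finite ?A" "?A \<subseteq> ?S" using fin h by auto
    have "?supp (c \<odot>\<^bsub>?F\<^esub> \<phi>) \<subseteq> ?A"
      using h(1) by (auto simp: tensor_free_sel)
    then have "tensor_eval K M N P b (c \<odot>\<^bsub>?F\<^esub> \<phi>) = (\<Oplus>\<^bsub>P\<^esub>p\<in>?A. (c \<odot>\<^bsub>?F\<^esub> \<phi>) p \<odot>\<^bsub>P\<^esub> ?b p)"
      using A h by (intro tensor_eval_eq F.smult_closed)
    also have "\<dots> = (\<Oplus>\<^bsub>P\<^esub>p\<in>?A. c \<odot>\<^bsub>P\<^esub> (\<phi> p \<odot>\<^bsub>P\<^esub> ?b p))"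
    proof (rule P.finsum_cong'[OF refl])
      show "(\<lambda>p. c \<odot>\<^bsub>P\<^esub> (\<phi> p \<odot>\<^bsub>P\<^esub> ?b p)) \<in> ?A \<rightarrow> carrier P"
        using h A(2) by (intro Pi_I P.smult_closed[OF h(1)] tensor_term_closed) auto
      fix p assume "p \<in> ?A"
      then have p: "p \<in> ?S" by blast
      have "(c \<odot>\<^bsub>?F\<^esub> \<phi>) p = c \<otimes>\<^bsub>K\<^esub> \<phi> p"
        using p by (simp only: tensor_free_sel restrict_apply if_True)
      then show "(c \<odot>\<^bsub>?F\<^esub> \<phi>) p \<odot>\<^bsub>P\<^esub> ?b p = c \<odot>\<^bsub>P\<^esub> (\<phi> p \<odot>\<^bsub>P\<^esub> ?b p)"
        using P.smult_assoc1[OF h(1) tensor_free_val[OF h(2) p] bc[OF p]] by (simp only:)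
    qed
    also have "\<dots> = c \<odot>\<^bsub>P\<^esub> tensor_eval K M N P b \<phi>"
      unfolding tensor_eval_def using h A
      by (intro P.finsum_smult_ldistr[symmetric] Pi_I tensor_term_closed) auto
    finally show "tensor_eval K M N P b (c \<odot>\<^bsub>?F\<^esub> \<phi>) = c \<odot>\<^bsub>P\<^esub> tensor_eval K M N P b \<phi>" .
  qed
qed

lemma tensor_eval_gen:
  assumes "x \<in> carrier M" "y \<in> carrier N"
  shows "tensor_eval K M N P b (tensor_gen K M N (x, y)) = b x y"
proof -
  have "tensor_eval K M N P b (tensor_gen K M N (x, y)) =
      (\<Oplus>\<^bsub>P\<^esub>p\<in>{(x, y)}. tensor_gen K M N (x, y) p \<odot>\<^bsub>P\<^esub> b (fst p) (snd p))"
    by (rule tensor_eval_eq[OF tensor_gen_closed])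
      (use assms bilinear_map_closed[OF assms] in \<open>auto simp: free_gen_def split: if_splits\<close>)
  also have "\<dots> = b x y"
    using assms bilinear_map_closed[OF assms] by (simp add: free_gen_def)
  finally show ?thesis .
qed

interpretation E: mod_hom K "tensor_free K M N" P "tensor_eval K M N P b"
  by unfold_locales (rule tensor_eval_hom)

lemma tensor_eval_null: "tensor_null K M N \<subseteq> E.ker"
proof -
  have kerI: "u \<ominus>\<^bsub>tensor_free K M N\<^esub> v \<in> E.ker"
    if "u \<in> carrier (tensor_free K M N)" "v \<in> carrier (tensor_free K M N)"
      "tensor_eval K M N P b u = tensor_eval K M N P b v" for u v
    using that by (simp add: E.ker_def P.r_neg P.minus_eq)
  have "tensor_relators K M N \<subseteq> E.ker"
    using b unfolding tensor_relators_def Let_def bilinear_map_def module_hom_def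
    by (elim conjE, intro Un_least subsetI; elim CollectE exE conjE; hypsubst; intro kerI)
      (simp_all add: tensor_eval_gen)
  then show ?thesis
    unfolding tensor_null_def by (rule F.span_is_subset) (rule E.ker_is_submodule)
qed

lemma tensor_lift_coset:
  assumes "\<phi> \<in> carrier (tensor_free K M N)"
  shows "tensor_lift K M N P b (tensor_null K M N +>\<^bsub>tensor_free K M N\<^esub> \<phi>) =
    tensor_eval K M N P b \<phi>"
proof -
  interpret T: submodule K "tensor_null K M N" "tensor_free K M N"
    by (rule tensor_null_submodule)
  have e: "tensor_eval K M N P b (n \<oplus>\<^bsub>tensor_free K M N\<^esub> \<phi>) = tensor_eval K M N P b \<phi>"
    if "n \<in> tensor_null K M N" for n
  proof -
    have "n \<in> E.ker" using that tensor_eval_null by blast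
    then show ?thesis using assms by (simp add: E.ker_def)
  qed
  have ne: "tensor_null K M N \<noteq> {}" using T.zero_closed by blast
  have "tensor_eval K M N P b ` (tensor_null K M N +>\<^bsub>tensor_free K M N\<^esub> \<phi>) =
      {tensor_eval K M N P b \<phi>}"
    unfolding a_r_coset_def' image_UN using ne by (simp add: e)
  then show ?thesis
    unfolding tensor_lift_def by (simp only: the_elem_eq)
qed

lemma tensor_lift_pure:
  assumes "x \<in> carrier M" "y \<in> carrier N"
  shows "tensor_lift K M N P b (pure_tensor K M N x y) = b x y"
  using assms by (simp add: pure_tensor_def tensor_lift_coset tensor_eval_gen)

lemma tensor_lift_hom: "tensor_lift K M N P b \<in> module_hom K (tensor K M N) P"
proof -
  note q = quotient_module_module[OF tensor_null_submodule]
  have car: "\<exists>\<phi>\<in>carrier (tensor_free K M N). t = tensor_null K M N +>\<^bsub>tensor_free K M N\<^esub> \<phi>"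
    if "t \<in> carrier (tensor K M N)" for t
    using that by (auto simp: tensor_def quotient_module_def A_RCOSETS_def')
  show ?thesis
    unfolding module_hom_def
  proof (intro CollectI conjI allI impI Pi_I; (elim conjE)?)
    fix t assume "t \<in> carrier (tensor K M N)"
    from car[OF this] show "tensor_lift K M N P b t \<in> carrier P"
      by (auto simp: tensor_lift_coset)
  next
    fix t u assume "t \<in> carrier (tensor K M N)" "u \<in> carrier (tensor K M N)"
    from this[THEN car] show "tensor_lift K M N P b (t \<oplus>\<^bsub>tensor K M N\<^esub> u) =
        tensor_lift K M N P b t \<oplus>\<^bsub>P\<^esub> tensor_lift K M N P b u"
      by (auto simp: tensor_def q(3) tensor_lift_coset)
  next
    fix c t assume c: "c \<in> carrier K" and "t \<in> carrier (tensor K M N)"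
    from car[OF this(2)] c show "tensor_lift K M N P b (c \<odot>\<^bsub>tensor K M N\<^esub> t) =
        c \<odot>\<^bsub>P\<^esub> tensor_lift K M N P b t"
      by (auto simp: tensor_def q(4) tensor_lift_coset)
  qed
qed

end

end

text \<open>
  Iterated tensor products are kept apart by their bracketing.  The three maps below are the
  linear maps sending \<open>x \<otimes> (y \<otimes> z)\<close> to \<open>b x y z\<close>, sending \<open>(x \<otimes> y) \<otimes> (z \<otimes> w)\<close> to \<open>b x y z w\<close>,
  and sending \<open>x \<otimes> y\<close> to \<open>f x \<otimes> g y\<close>, for multilinear \<open>b\<close> and linear \<open>f\<close> and \<open>g\<close>.
\<close>

definition tensor_lift3 where
  "tensor_lift3 K A B C P b =
    tensor_lift K A (tensor K B C) P (\<lambda>x. tensor_lift K B C P (\<lambda>y z. b x y z))"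

definition tensor_lift22 where
  "tensor_lift22 K A B C D P b =
    tensor_lift K (tensor K A B) (tensor K C D) P
      (\<lambda>u v. tensor_lift K A B P (\<lambda>x y. tensor_lift K C D P (\<lambda>z w. b x y z w) v) u)"

definition tensor_map where
  "tensor_map K M N M' N' f g =
    tensor_lift K M N (tensor K M' N') (\<lambda>x y. pure_tensor K M' N' (f x) (g y))"

definition tensor_assoc where
  "tensor_assoc K A B C =
    tensor_lift K (tensor K A B) C (tensor K A (tensor K B C))
      (\<lambda>t z. tensor_lift K A B (tensor K A (tensor K B C))
        (\<lambda>x y. pure_tensor K A (tensor K B C) x (pure_tensor K B C y z)) t)"

definition tensor_assoc_inv where
  "tensor_assoc_inv K A B C =
    tensor_lift3 K A B C (tensor K (tensor K A B) C)
      (\<lambda>x y z. pure_tensor K (tensor K A B) C (pure_tensor K A B x y) z)"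

lemma tensor_lift_param:
  assumes M: "module K M" and N: "module K N" and P: "module K P" and Q: "module K Q"
    and b: "\<And>s. s \<in> carrier Q \<Longrightarrow> bilinear_map K M N P (b s)"
    and h: "\<And>x y. x \<in> carrier M \<Longrightarrow> y \<in> carrier N \<Longrightarrow> (\<lambda>s. b s x y) \<in> module_hom K Q P"
    and t: "t \<in> carrier (tensor K M N)"
  shows "(\<lambda>s. tensor_lift K M N P (b s) t) \<in> module_hom K Q P"
proof -
  interpret M: module K M by (rule M)
  interpret P: module K P by (rule P)
  interpret Q: module K Q by (rule Q)
  obtain \<phi> where \<phi>: "\<phi> \<in> carrier (tensor_free K M N)"
    and t\<phi>: "t = tensor_null K M N +>\<^bsub>tensor_free K M N\<^esub> \<phi>"
    using t by (auto simp: tensor_def quotient_module_def A_RCOSETS_def')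
  let ?A = "{p \<in> carrier M \<times> carrier N. \<phi> p \<noteq> \<zero>\<^bsub>K\<^esub>}"
  have fin: "finite ?A"
    using \<phi> by (simp add: free_module_sel[OF M.is_cring])
  have val: "\<phi> p \<in> carrier K" if "p \<in> ?A" for p
    using that \<phi> by (intro tensor_free_val[OF M N]) auto
  have hp: "(\<lambda>s. b s (fst p) (snd p)) \<in> module_hom K Q P" if "p \<in> ?A" for p
    using that by (intro h) auto
  have eq: "tensor_lift K M N P (b s) t =
      (\<Oplus>\<^bsub>P\<^esub>p\<in>?A. \<phi> p \<odot>\<^bsub>P\<^esub> b s (fst p) (snd p))" if "s \<in> carrier Q" for s
    using tensor_lift_coset[OF M N P b[OF that] \<phi>] by (simp only: t\<phi> tensor_eval_def)
  have cl: "\<phi> p \<odot>\<^bsub>P\<^esub> b s (fst p) (snd p) \<in> carrier P" if "s \<in> carrier Q" "p \<in> ?A" for s p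
    using val[OF that(2)] module_hom_closed[OF hp[OF that(2)]] that(1)
    by (intro P.smult_closed) auto
  show ?thesis
    unfolding module_hom_def
  proof (intro CollectI conjI allI impI Pi_I; (elim conjE)?)
    fix s assume s: "s \<in> carrier Q"
    show "tensor_lift K M N P (b s) t \<in> carrier P"
      unfolding eq[OF s] using cl[OF s] by (intro P.finsum_closed) blast
  next
    fix s s' assume s: "s \<in> carrier Q" "s' \<in> carrier Q"
    show "tensor_lift K M N P (b (s \<oplus>\<^bsub>Q\<^esub> s')) t =
        tensor_lift K M N P (b s) t \<oplus>\<^bsub>P\<^esub> tensor_lift K M N P (b s') t"
      unfolding eq[OF s(1)] eq[OF s(2)] eq[OF Q.a_closed[OF s]]
    proof (subst P.finsum_addf[symmetric])
      show "(\<Oplus>\<^bsub>P\<^esub>p\<in>?A. \<phi> p \<odot>\<^bsub>P\<^esub> b (s \<oplus>\<^bsub>Q\<^esub> s') (fst p) (snd p)) =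
        (\<Oplus>\<^bsub>P\<^esub>p\<in>?A. \<phi> p \<odot>\<^bsub>P\<^esub> b s (fst p) (snd p) \<oplus>\<^bsub>P\<^esub> \<phi> p \<odot>\<^bsub>P\<^esub> b s' (fst p) (snd p))"
      proof (rule P.finsum_cong'[OF refl])
        fix p assume p: "p \<in> ?A"
        show "\<phi> p \<odot>\<^bsub>P\<^esub> b (s \<oplus>\<^bsub>Q\<^esub> s') (fst p) (snd p) =
            \<phi> p \<odot>\<^bsub>P\<^esub> b s (fst p) (snd p) \<oplus>\<^bsub>P\<^esub> \<phi> p \<odot>\<^bsub>P\<^esub> b s' (fst p) (snd p)"
          unfolding module_hom_add[OF hp[OF p] s]
          using val[OF p] module_hom_closed[OF hp[OF p]] s by (intro P.smult_r_distr) auto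
      qed (use cl s in blast)
    qed (use cl s in blast)+
  next
    fix c s assume c: "c \<in> carrier K" and s: "s \<in> carrier Q"
    show "tensor_lift K M N P (b (c \<odot>\<^bsub>Q\<^esub> s)) t = c \<odot>\<^bsub>P\<^esub> tensor_lift K M N P (b s) t"
      unfolding eq[OF s] eq[OF Q.smult_closed[OF c s]]
    proof (subst P.finsum_smult_ldistr[OF fin c])
      show "(\<Oplus>\<^bsub>P\<^esub>p\<in>?A. \<phi> p \<odot>\<^bsub>P\<^esub> b (c \<odot>\<^bsub>Q\<^esub> s) (fst p) (snd p)) =
        (\<Oplus>\<^bsub>P\<^esub>p\<in>?A. c \<odot>\<^bsub>P\<^esub> (\<phi> p \<odot>\<^bsub>P\<^esub> b s (fst p) (snd p)))"
      proof (rule P.finsum_cong'[OF refl])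
        fix p assume p: "p \<in> ?A"
        have v: "\<phi> p \<in> carrier K" "b s (fst p) (snd p) \<in> carrier P"
          using val[OF p] module_hom_closed[OF hp[OF p]] s by auto
        show "\<phi> p \<odot>\<^bsub>P\<^esub> b (c \<odot>\<^bsub>Q\<^esub> s) (fst p) (snd p) = c \<odot>\<^bsub>P\<^esub> (\<phi> p \<odot>\<^bsub>P\<^esub> b s (fst p) (snd p))"
          unfolding module_hom_smult[OF hp[OF p] c s]
          using P.smult_assoc1[OF v(1) c v(2)] P.smult_assoc1[OF c v(1) v(2)] M.R.m_comm[OF c v(1)]
          by simp
      qed (use cl c s in blast)
    qed (use cl c s in blast)+
  qed
qed

lemma
  assumes A: "module K A" and B: "module K B" and C: "module K C" and P: "module K P"
    and b: "trilinear_map K A B C P b"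
  shows tensor_lift3_hom: "tensor_lift3 K A B C P b \<in> module_hom K (tensor K A (tensor K B C)) P"
    and tensor_lift3_pure: "\<And>x y z. x \<in> carrier A \<Longrightarrow> y \<in> carrier B \<Longrightarrow> z \<in> carrier C \<Longrightarrow>
      tensor_lift3 K A B C P b (pure_tensor K A (tensor K B C) x (pure_tensor K B C y z)) = b x y z"
proof -
  have bb: "bilinear_map K B C P (b x)" if "x \<in> carrier A" for x
    using b that by (simp add: trilinear_map_def)
  have bil: "bilinear_map K A (tensor K B C) P (\<lambda>x. tensor_lift K B C P (b x))"
    unfolding bilinear_map_def
  proof (intro conjI ballI)
    fix t assume t: "t \<in> carrier (tensor K B C)"
    show "(\<lambda>x. tensor_lift K B C P (b x) t) \<in> module_hom K A P"
      by (rule tensor_lift_param[OF B C P A bb _ t]) (use b in \<open>simp_all add: trilinear_map_def\<close>)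
  next
    fix x assume "x \<in> carrier A"
    then show "tensor_lift K B C P (b x) \<in> module_hom K (tensor K B C) P"
      by (intro tensor_lift_hom B C P bb)
  qed
  note BC = tensor_module[OF B C]
  show "tensor_lift3 K A B C P b \<in> module_hom K (tensor K A (tensor K B C)) P"
    unfolding tensor_lift3_def by (rule tensor_lift_hom[OF A BC P bil])
  show "tensor_lift3 K A B C P b (pure_tensor K A (tensor K B C) x (pure_tensor K B C y z)) = b x y z"
    if "x \<in> carrier A" "y \<in> carrier B" "z \<in> carrier C" for x y z
    unfolding tensor_lift3_def
    using tensor_lift_pure[OF A BC P bil that(1) pure_tensor_closed[OF B C that(2,3)]]
      tensor_lift_pure[OF B C P bb[OF that(1)] that(2,3)] by simp
qed

lemma
  assumes A: "module K A" and B: "module K B" and C: "module K C" and D: "module K D"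
    and P: "module K P"
    and b1: "\<And>z w. z \<in> carrier C \<Longrightarrow> w \<in> carrier D \<Longrightarrow> bilinear_map K A B P (\<lambda>x y. b x y z w)"
    and b2: "\<And>x y. x \<in> carrier A \<Longrightarrow> y \<in> carrier B \<Longrightarrow> bilinear_map K C D P (b x y)"
  shows tensor_lift22_hom:
      "tensor_lift22 K A B C D P b \<in> module_hom K (tensor K (tensor K A B) (tensor K C D)) P"
    and tensor_lift22_pure:
      "\<And>x y z w. x \<in> carrier A \<Longrightarrow> y \<in> carrier B \<Longrightarrow> z \<in> carrier C \<Longrightarrow> w \<in> carrier D \<Longrightarrow>
        tensor_lift22 K A B C D P b
          (pure_tensor K (tensor K A B) (tensor K C D) (pure_tensor K A B x y) (pure_tensor K C D z w))
        = b x y z w"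
proof -
  note AB = tensor_module[OF A B] and CD = tensor_module[OF C D]
  have in1: "bilinear_map K A B P (\<lambda>x y. tensor_lift K C D P (b x y) v)"
    if v: "v \<in> carrier (tensor K C D)" for v
    unfolding bilinear_map_def
  proof (intro conjI ballI)
    fix y assume y: "y \<in> carrier B"
    show "(\<lambda>x. tensor_lift K C D P (b x y) v) \<in> module_hom K A P"
      by (rule tensor_lift_param[OF C D P A _ _ v])
        (use b1 b2 y in \<open>simp_all add: bilinear_map_def\<close>)
  next
    fix x assume x: "x \<in> carrier A"
    show "(\<lambda>y. tensor_lift K C D P (b x y) v) \<in> module_hom K B P"
      by (rule tensor_lift_param[OF C D P B _ _ v])
        (use b1 b2 x in \<open>simp_all add: bilinear_map_def\<close>)
  qed
  have bil: "bilinear_map K (tensor K A B) (tensor K C D) P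
      (\<lambda>u v. tensor_lift K A B P (\<lambda>x y. tensor_lift K C D P (\<lambda>z w. b x y z w) v) u)"
    unfolding bilinear_map_def
  proof (intro conjI ballI)
    fix v assume "v \<in> carrier (tensor K C D)"
    then show "(\<lambda>u. tensor_lift K A B P (\<lambda>x y. tensor_lift K C D P (\<lambda>z w. b x y z w) v) u)
        \<in> module_hom K (tensor K A B) P"
      using tensor_lift_hom[OF A B P in1] by simp
  next
    fix u assume u: "u \<in> carrier (tensor K A B)"
    show "(\<lambda>v. tensor_lift K A B P (\<lambda>x y. tensor_lift K C D P (\<lambda>z w. b x y z w) v) u)
        \<in> module_hom K (tensor K C D) P"
      by (rule tensor_lift_param[OF A B P CD in1 _ u]) (auto intro: tensor_lift_hom[OF C D P b2])
  qed
  show "tensor_lift22 K A B C D P b \<in> module_hom K (tensor K (tensor K A B) (tensor K C D)) P"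
    unfolding tensor_lift22_def by (rule tensor_lift_hom[OF AB CD P bil])
  show "tensor_lift22 K A B C D P b
      (pure_tensor K (tensor K A B) (tensor K C D) (pure_tensor K A B x y) (pure_tensor K C D z w))
        = b x y z w"
    if "x \<in> carrier A" "y \<in> carrier B" "z \<in> carrier C" "w \<in> carrier D" for x y z w
    unfolding tensor_lift22_def
    using tensor_lift_pure[OF AB CD P bil pure_tensor_closed[OF A B that(1,2)]
        pure_tensor_closed[OF C D that(3,4)]]
      tensor_lift_pure[OF A B P in1[OF pure_tensor_closed[OF C D that(3,4)]] that(1,2)]
      tensor_lift_pure[OF C D P b2[OF that(1,2)] that(3,4)]
    by simp
qed


lemma trilinear_mapI:
  assumes "\<And>y z. y \<in> carrier B \<Longrightarrow> z \<in> carrier C \<Longrightarrow> (\<lambda>x. b x y z) \<in> module_hom K A P"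
    and "\<And>x z. x \<in> carrier A \<Longrightarrow> z \<in> carrier C \<Longrightarrow> (\<lambda>y. b x y z) \<in> module_hom K B P"
    and "\<And>x y. x \<in> carrier A \<Longrightarrow> y \<in> carrier B \<Longrightarrow> (\<lambda>z. b x y z) \<in> module_hom K C P"
  shows "trilinear_map K A B C P b"
  using assms by (simp add: trilinear_map_def bilinear_map_def)

lemma tensor_lift3_param:
  assumes A: "module K A" and B: "module K B" and C: "module K C" and P: "module K P"
    and Q: "module K Q"
    and b: "\<And>s. s \<in> carrier Q \<Longrightarrow> trilinear_map K A B C P (b s)"
    and h: "\<And>x y z. x \<in> carrier A \<Longrightarrow> y \<in> carrier B \<Longrightarrow> z \<in> carrier C \<Longrightarrow>
      (\<lambda>s. b s x y z) \<in> module_hom K Q P"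
    and t: "t \<in> carrier (tensor K A (tensor K B C))"
  shows "(\<lambda>s. tensor_lift3 K A B C P (b s) t) \<in> module_hom K Q P"
proof -
  have bb: "bilinear_map K B C P (b s x)" if "s \<in> carrier Q" "x \<in> carrier A" for s x
    using b that by (simp add: trilinear_map_def)
  have bil: "bilinear_map K A (tensor K B C) P (\<lambda>x. tensor_lift K B C P (b s x))"
    if s: "s \<in> carrier Q" for s
    unfolding bilinear_map_def
  proof (intro conjI ballI)
    fix t assume t: "t \<in> carrier (tensor K B C)"
    show "(\<lambda>x. tensor_lift K B C P (b s x) t) \<in> module_hom K A P"
      by (rule tensor_lift_param[OF B C P A bb[OF s] _ t])
        (use b[OF s] in \<open>simp_all add: trilinear_map_def\<close>)
  qed (intro tensor_lift_hom B C P bb s)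
  show ?thesis
    unfolding tensor_lift3_def
  proof (rule tensor_lift_param[OF A tensor_module[OF B C] P Q _ _ t])
    fix x u assume x: "x \<in> carrier A" and u: "u \<in> carrier (tensor K B C)"
    show "(\<lambda>s. tensor_lift K B C P (b s x) u) \<in> module_hom K Q P"
      by (rule tensor_lift_param[OF B C P Q bb[OF _ x] h[OF x] u])
  qed (rule bil)
qed

lemma module_hom_comp:
  assumes "f \<in> module_hom K A B" "g \<in> module_hom K B C"
  shows "(\<lambda>x. g (f x)) \<in> module_hom K A C"
  using assms by (simp add: module_hom_def Pi_iff)

lemma module_hom_sum:
  assumes "module K B" "f \<in> module_hom K A B" "g \<in> module_hom K A B"
  shows "(\<lambda>x. f x \<oplus>\<^bsub>B\<^esub> g x) \<in> module_hom K A B"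
proof -
  interpret B: module K B by fact
  show ?thesis using assms(2,3) by (auto simp: module_hom_def Pi_iff B.a_ac B.smult_r_distr)
qed

lemma pure_tensor_hom:
  assumes "module K M" "module K N"
  shows "y \<in> carrier N \<Longrightarrow> (\<lambda>x. pure_tensor K M N x y) \<in> module_hom K M (tensor K M N)"
    and "x \<in> carrier M \<Longrightarrow> pure_tensor K M N x \<in> module_hom K N (tensor K M N)"
  using pure_tensor_bilinear[OF assms] by (simp_all add: bilinear_map_def)

lemma
  assumes M: "module K M" and N: "module K N" and M': "module K M'" and N': "module K N'"
    and f: "f \<in> module_hom K M M'" and g: "g \<in> module_hom K N N'"
  shows tensor_map_hom: "tensor_map K M N M' N' f g \<in> module_hom K (tensor K M N) (tensor K M' N')"
    and tensor_map_pure: "\<And>x y. x \<in> carrier M \<Longrightarrow> y \<in> carrier N \<Longrightarrow>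
      tensor_map K M N M' N' f g (pure_tensor K M N x y) = pure_tensor K M' N' (f x) (g y)"
proof -
  note T = tensor_module[OF M' N']
  have bil: "bilinear_map K M N (tensor K M' N') (\<lambda>x y. pure_tensor K M' N' (f x) (g y))"
    unfolding bilinear_map_def
  proof (intro conjI ballI)
    fix y assume y: "y \<in> carrier N"
    have gy: "g y \<in> carrier N'" using module_hom_closed[OF g] y by blast
    show "(\<lambda>x. pure_tensor K M' N' (f x) (g y)) \<in> module_hom K M (tensor K M' N')"
      by (rule module_hom_comp[OF f pure_tensor_hom(1)[OF M' N' gy]])
  next
    fix x assume x: "x \<in> carrier M"
    have fx: "f x \<in> carrier M'" using module_hom_closed[OF f] x by blast
    show "(\<lambda>y. pure_tensor K M' N' (f x) (g y)) \<in> module_hom K N (tensor K M' N')"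
      by (rule module_hom_comp[OF g pure_tensor_hom(2)[OF M' N' fx]])
  qed
  show "tensor_map K M N M' N' f g \<in> module_hom K (tensor K M N) (tensor K M' N')"
    unfolding tensor_map_def by (rule tensor_lift_hom[OF M N T bil])
  show "tensor_map K M N M' N' f g (pure_tensor K M N x y) = pure_tensor K M' N' (f x) (g y)"
    if "x \<in> carrier M" "y \<in> carrier N" for x y
    unfolding tensor_map_def by (rule tensor_lift_pure[OF M N T bil that])
qed


section \<open>Yang-Baxter operators\<close>

text \<open>
  The braid equation is stated on \<open>(V \<otimes> V) \<otimes> V\<close>; there the operator \<open>1 \<otimes> R\<close> on \<open>V \<otimes> (V \<otimes> V)\<close> is
  transported along the associativity isomorphism.
\<close>

definition yb_left where
  "yb_left K V R = tensor_map K (tensor K V V) V (tensor K V V) V R id"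

definition yb_right where
  "yb_right K V R =
    tensor_assoc_inv K V V V \<circ> tensor_map K V (tensor K V V) V (tensor K V V) id R
      \<circ> tensor_assoc K V V V"

definition yang_baxter_operator where
  "yang_baxter_operator K V R \<longleftrightarrow>
    linear_map K (tensor K V V) (tensor K V V) R \<and>
    bij_betw R (carrier (tensor K V V)) (carrier (tensor K V V)) \<and>
    (\<forall>t\<in>carrier (tensor K (tensor K V V) V).
      yb_left K V R (yb_right K V R (yb_left K V R t)) =
      yb_right K V R (yb_left K V R (yb_right K V R t)))"


section \<open>3-Lie algebras\<close>

locale three_Lie_algebra = vectorspace K L
  for K :: "('k, 'm) ring_scheme" and L :: "('k, 'l, 'n) module_scheme" +
  fixes br :: "'l \<Rightarrow> 'l \<Rightarrow> 'l \<Rightarrow> 'l"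
  assumes linear1:
      "\<lbrakk>y \<in> carrier L; z \<in> carrier L\<rbrakk> \<Longrightarrow> (\<lambda>x. br x y z) \<in> module_hom K L L"
    and linear2:
      "\<lbrakk>x \<in> carrier L; z \<in> carrier L\<rbrakk> \<Longrightarrow> (\<lambda>y. br x y z) \<in> module_hom K L L"
    and linear3:
      "\<lbrakk>x \<in> carrier L; y \<in> carrier L\<rbrakk> \<Longrightarrow> (\<lambda>z. br x y z) \<in> module_hom K L L"
    and skew:
      "\<lbrakk>\<sigma> permutes {1, 2, 3 :: nat}; v \<in> {1, 2, 3} \<rightarrow> carrier L\<rbrakk> \<Longrightarrow>
        br (v 1) (v 2) (v 3) = [sign \<sigma>] \<cdot>\<^bsub>L\<^esub> br (v (\<sigma> 1)) (v (\<sigma> 2)) (v (\<sigma> 3))"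
    and fundamental:
      "\<lbrakk>x1 \<in> carrier L; x2 \<in> carrier L; x3 \<in> carrier L; x4 \<in> carrier L; x5 \<in> carrier L\<rbrakk> \<Longrightarrow>
        br (br x1 x2 x3) x4 x5 =
          br (br x1 x4 x5) x2 x3 \<oplus>\<^bsub>L\<^esub> br x1 (br x2 x4 x5) x3 \<oplus>\<^bsub>L\<^esub> br x1 x2 (br x3 x4 x5)"

definition lie_ext :: "('k, 'm) ring_scheme \<Rightarrow> ('k, 'l, 'n) module_scheme \<Rightarrow> ('k, 'k \<times> 'l) module"
  where "lie_ext K L = direct_sum (regular_module K) L"

definition lie_comult where
  "lie_comult K L =
    (let X = lie_ext K L in
      (\<lambda>(a, x). pure_tensor K X X (a, x) (\<one>\<^bsub>K\<^esub>, \<zero>\<^bsub>L\<^esub>) \<oplus>\<^bsub>tensor K X X\<^esub>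
                pure_tensor K X X (\<one>\<^bsub>K\<^esub>, \<zero>\<^bsub>L\<^esub>) (\<zero>\<^bsub>K\<^esub>, x)))"

definition lie_ternary where
  "lie_ternary K L br =
    (let X = lie_ext K L in
      tensor_lift3 K X X X X
        (\<lambda>(a, x) (b, y) (c, z). (a \<otimes>\<^bsub>K\<^esub> b \<otimes>\<^bsub>K\<^esub> c, (b \<otimes>\<^bsub>K\<^esub> c) \<odot>\<^bsub>L\<^esub> x \<oplus>\<^bsub>L\<^esub> br x y z)))"

text \<open>
  Sweedler notation: for \<open>h\<close> trilinear with values in \<open>P\<close>, the sum of \<open>h z1 z2 z3\<close> over the terms
  \<open>z1 \<otimes> (z2 \<otimes> z3)\<close> of \<open>(1 \<otimes> \<Delta>) (\<Delta> z)\<close>.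
\<close>

definition sweedler3 where
  "sweedler3 K L P z h =
    (let X = lie_ext K L in
      tensor_lift3 K X X X P h
        (tensor_map K X X X (tensor K X X) id (lie_comult K L) (lie_comult K L z)))"

text \<open>
  The lemmas \<open>lie_yb_map_hom\<close> and \<open>lie_yb_map_pure\<close> below confirm that this is the linear map with
  the stated values on pure tensors.
\<close>

definition lie_yb_map where
  "lie_yb_map K L br =
    (let X = lie_ext K L; V = tensor K X X;
         T = (\<lambda>x y z. lie_ternary K L br (pure_tensor K X V x (pure_tensor K X X y z)))
     in tensor_lift22 K X X X X (tensor K V V)
       (\<lambda>x y z w.
          sweedler3 K L (tensor K V V) z (\<lambda>z1 z2 z3.
          sweedler3 K L (tensor K V V) w (\<lambda>w1 w2 w3.
            pure_tensor K V V (pure_tensor K X X z1 w1)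
              (pure_tensor K X X (T x z2 w2) (T y z3 w3))))))"

context three_Lie_algebra
begin

abbreviation (input) "X \<equiv> lie_ext K L"
abbreviation (input) "V \<equiv> tensor K X X"

lemma lie_ext_sel:
  "carrier X = carrier K \<times> carrier L" "zero X = (\<zero>\<^bsub>K\<^esub>, \<zero>\<^bsub>L\<^esub>)"
  "add X = (\<lambda>v w. (fst v \<oplus>\<^bsub>K\<^esub> fst w, snd v \<oplus>\<^bsub>L\<^esub> snd w))"
  "smult X = (\<lambda>c v. (c \<otimes>\<^bsub>K\<^esub> fst v, c \<odot>\<^bsub>L\<^esub> snd v))"
  by (simp_all add: lie_ext_def direct_sum_def regular_module_def)

lemma regular_module: "module K (regular_module K)"
proof -
  have "abelian_group (regular_module K)"
    by (rule abelian_groupI) (auto simp: regular_module_def R.a_ac intro: R.l_neg bexI[of _ "\<ominus>\<^bsub>K\<^esub> _"])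
  then show ?thesis
    by (intro moduleI) (auto simp: regular_module_def R.l_distr R.r_distr R.m_assoc R.is_cring)
qed

lemma lie_ext_module: "module K X"
  unfolding lie_ext_def by (rule direct_sum_is_module[OF regular_module module_axioms])

lemma V_module: "module K V" by (rule tensor_module[OF lie_ext_module lie_ext_module])

lemma XV_module: "module K (tensor K X V)" by (rule tensor_module[OF lie_ext_module V_module])

lemma VV_module: "module K (tensor K V V)" by (rule tensor_module[OF V_module V_module])

lemma br_hom:
  "\<lbrakk>x \<in> carrier L; y \<in> carrier L; z \<in> carrier L\<rbrakk> \<Longrightarrow> br x y z \<in> carrier L"
  "\<lbrakk>x \<in> carrier L; x' \<in> carrier L; y \<in> carrier L; z \<in> carrier L\<rbrakk> \<Longrightarrow>
    br (x \<oplus>\<^bsub>L\<^esub> x') y z = br x y z \<oplus>\<^bsub>L\<^esub> br x' y z"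
  "\<lbrakk>x \<in> carrier L; y \<in> carrier L; y' \<in> carrier L; z \<in> carrier L\<rbrakk> \<Longrightarrow>
    br x (y \<oplus>\<^bsub>L\<^esub> y') z = br x y z \<oplus>\<^bsub>L\<^esub> br x y' z"
  "\<lbrakk>x \<in> carrier L; y \<in> carrier L; z \<in> carrier L; z' \<in> carrier L\<rbrakk> \<Longrightarrow>
    br x y (z \<oplus>\<^bsub>L\<^esub> z') = br x y z \<oplus>\<^bsub>L\<^esub> br x y z'"
  "\<lbrakk>c \<in> carrier K; x \<in> carrier L; y \<in> carrier L; z \<in> carrier L\<rbrakk> \<Longrightarrow>
    br (c \<odot>\<^bsub>L\<^esub> x) y z = c \<odot>\<^bsub>L\<^esub> br x y z"
  "\<lbrakk>c \<in> carrier K; x \<in> carrier L; y \<in> carrier L; z \<in> carrier L\<rbrakk> \<Longrightarrow>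
    br x (c \<odot>\<^bsub>L\<^esub> y) z = c \<odot>\<^bsub>L\<^esub> br x y z"
  "\<lbrakk>c \<in> carrier K; x \<in> carrier L; y \<in> carrier L; z \<in> carrier L\<rbrakk> \<Longrightarrow>
    br x y (c \<odot>\<^bsub>L\<^esub> z) = c \<odot>\<^bsub>L\<^esub> br x y z"
  using linear1 linear2 linear3 by (simp_all add: module_hom_def Pi_iff)

lemma lie_ternary_trilinear:
  "trilinear_map K X X X X (\<lambda>(a, x) (b, y) (c, z).
    (a \<otimes>\<^bsub>K\<^esub> b \<otimes>\<^bsub>K\<^esub> c, (b \<otimes>\<^bsub>K\<^esub> c) \<odot>\<^bsub>L\<^esub> x \<oplus>\<^bsub>L\<^esub> br x y z))"
  by (rule trilinear_mapI; clarsimp simp: module_hom_def lie_ext_sel br_hom Pi_iff)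
    (simp_all add: br_hom R.l_distr R.r_distr R.m_ac smult_l_distr smult_r_distr
      smult_assoc1[symmetric] a_ac)


abbreviation (input) "T x y z \<equiv> lie_ternary K L br (pure_tensor K X V x (pure_tensor K X X y z))"

lemma lie_ternary_pure:
  assumes "(a, x) \<in> carrier X" "(b, y) \<in> carrier X" "(c, z) \<in> carrier X"
  shows "T (a, x) (b, y) (c, z) =
    (a \<otimes>\<^bsub>K\<^esub> b \<otimes>\<^bsub>K\<^esub> c, (b \<otimes>\<^bsub>K\<^esub> c) \<odot>\<^bsub>L\<^esub> x \<oplus>\<^bsub>L\<^esub> br x y z)"
  using tensor_lift3_pure[OF lie_ext_module lie_ext_module lie_ext_module lie_ext_module
      lie_ternary_trilinear assms]
  by (simp add: lie_ternary_def Let_def)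

lemma lie_ternary_hom: "lie_ternary K L br \<in> module_hom K (tensor K X V) X"
  unfolding lie_ternary_def Let_def
  by (intro tensor_lift3_hom lie_ext_module lie_ternary_trilinear)

lemma T_hom:
  "y \<in> carrier X \<Longrightarrow> z \<in> carrier X \<Longrightarrow> (\<lambda>x. T x y z) \<in> module_hom K X X"
  "x \<in> carrier X \<Longrightarrow> z \<in> carrier X \<Longrightarrow> (\<lambda>y. T x y z) \<in> module_hom K X X"
  "x \<in> carrier X \<Longrightarrow> y \<in> carrier X \<Longrightarrow> (\<lambda>z. T x y z) \<in> module_hom K X X"
proof -
  note X = lie_ext_module and XX = module_hom_comp[OF module_hom_comp lie_ternary_hom]
  show "(\<lambda>x. T x y z) \<in> module_hom K X X" if "y \<in> carrier X" "z \<in> carrier X"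
    by (rule module_hom_comp[OF pure_tensor_hom(1)[OF X V_module] lie_ternary_hom])
      (rule pure_tensor_closed[OF X X that])
  show "(\<lambda>y. T x y z) \<in> module_hom K X X" if "x \<in> carrier X" "z \<in> carrier X"
    by (rule XX[OF pure_tensor_hom(1)[OF X X that(2)] pure_tensor_hom(2)[OF X V_module that(1)]])
  show "(\<lambda>z. T x y z) \<in> module_hom K X X" if "x \<in> carrier X" "y \<in> carrier X"
    by (rule XX[OF pure_tensor_hom(2)[OF X X that(2)] pure_tensor_hom(2)[OF X V_module that(1)]])
qed

lemma T_closed:
  "x \<in> carrier X \<Longrightarrow> y \<in> carrier X \<Longrightarrow> z \<in> carrier X \<Longrightarrow> T x y z \<in> carrier X"
  using module_hom_closed[OF T_hom(1)] by blast

lemma lie_comult_hom: "lie_comult K L \<in> module_hom K X V"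
proof -
  let ?e = "(\<one>\<^bsub>K\<^esub>, \<zero>\<^bsub>L\<^esub>)"
  have e: "?e \<in> carrier X" by (simp add: lie_ext_sel)
  have p: "(\<lambda>v. (\<zero>\<^bsub>K\<^esub>, snd v)) \<in> module_hom K X X"
    by (auto simp: module_hom_def lie_ext_sel)
  have f: "(\<lambda>v. pure_tensor K X X v ?e) \<in> module_hom K X V"
    by (rule pure_tensor_hom[OF lie_ext_module lie_ext_module e])
  have g: "(\<lambda>v. pure_tensor K X X ?e (\<zero>\<^bsub>K\<^esub>, snd v)) \<in> module_hom K X V"
    by (rule module_hom_comp[OF p pure_tensor_hom(2)[OF lie_ext_module lie_ext_module e]])
  have eq: "lie_comult K L = (\<lambda>v. pure_tensor K X X v ?e \<oplus>\<^bsub>V\<^esub> pure_tensor K X X ?e (\<zero>\<^bsub>K\<^esub>, snd v))"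
    by (rule ext) (simp add: lie_comult_def Let_def split: prod.split)
  show ?thesis
    unfolding eq by (rule module_hom_sum[OF V_module f g])
qed

abbreviation (input) "D z \<equiv> tensor_map K X X X V id (lie_comult K L) (lie_comult K L z)"

lemma D_hom: "(\<lambda>z. D z) \<in> module_hom K X (tensor K X V)"
proof (rule module_hom_comp[OF lie_comult_hom])
  show "tensor_map K X X X V id (lie_comult K L) \<in> module_hom K V (tensor K X V)"
    by (intro tensor_map_hom lie_ext_module V_module lie_comult_hom) (simp add: module_hom_def)
qed

lemma sweedler3_hom:
  assumes "module K P" "trilinear_map K X X X P h"
  shows "(\<lambda>z. sweedler3 K L P z h) \<in> module_hom K X P"
  unfolding sweedler3_def Let_def
  by (rule module_hom_comp[OF D_hom])
    (intro tensor_lift3_hom lie_ext_module assms)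

lemma sweedler3_param:
  assumes "module K P" "module K Q" "\<And>s. s \<in> carrier Q \<Longrightarrow> trilinear_map K X X X P (h s)"
    and "\<And>x y z. x \<in> carrier X \<Longrightarrow> y \<in> carrier X \<Longrightarrow> z \<in> carrier X \<Longrightarrow>
      (\<lambda>s. h s x y z) \<in> module_hom K Q P"
    and "z \<in> carrier X"
  shows "(\<lambda>s. sweedler3 K L P z (h s)) \<in> module_hom K Q P"
proof -
  have "D z \<in> carrier (tensor K X V)"
    using module_hom_closed[OF D_hom] assms(5) by blast
  then show ?thesis
    unfolding sweedler3_def Let_def
    using assms by (intro tensor_lift3_param lie_ext_module)
qed

abbreviation (input) "yb_term x y z1 z2 z3 w1 w2 w3 \<equiv>
  pure_tensor K V V (pure_tensor K X X z1 w1) (pure_tensor K X X (T x z2 w2) (T y z3 w3))"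

abbreviation (input) "yb_expr x y z w \<equiv>
  sweedler3 K L (tensor K V V) z (\<lambda>z1 z2 z3. sweedler3 K L (tensor K V V) w (\<lambda>w1 w2 w3.
    yb_term x y z1 z2 z3 w1 w2 w3))"

lemma yb_term_hom:
  assumes c: "x \<in> carrier X" "y \<in> carrier X" "z1 \<in> carrier X" "z2 \<in> carrier X" "z3 \<in> carrier X"
    "w1 \<in> carrier X" "w2 \<in> carrier X" "w3 \<in> carrier X"
  shows "(\<lambda>x. yb_term x y z1 z2 z3 w1 w2 w3) \<in> module_hom K X (tensor K V V)"
    and "(\<lambda>y. yb_term x y z1 z2 z3 w1 w2 w3) \<in> module_hom K X (tensor K V V)"
    and "(\<lambda>z1. yb_term x y z1 z2 z3 w1 w2 w3) \<in> module_hom K X (tensor K V V)"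
    and "(\<lambda>z2. yb_term x y z1 z2 z3 w1 w2 w3) \<in> module_hom K X (tensor K V V)"
    and "(\<lambda>z3. yb_term x y z1 z2 z3 w1 w2 w3) \<in> module_hom K X (tensor K V V)"
    and "(\<lambda>w1. yb_term x y z1 z2 z3 w1 w2 w3) \<in> module_hom K X (tensor K V V)"
    and "(\<lambda>w2. yb_term x y z1 z2 z3 w1 w2 w3) \<in> module_hom K X (tensor K V V)"
    and "(\<lambda>w3. yb_term x y z1 z2 z3 w1 w2 w3) \<in> module_hom K X (tensor K V V)"
proof -
  note X = lie_ext_module and V = V_module
  have zw: "pure_tensor K X X z1 w1 \<in> carrier V"
    and TT: "pure_tensor K X X (T x z2 w2) (T y z3 w3) \<in> carrier V"
    by (intro pure_tensor_closed X T_closed c)+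
  note left = module_hom_comp[OF _ module_hom_comp[OF pure_tensor_hom(1)[OF X X]
    pure_tensor_hom(2)[OF V V zw]]]
  note right = module_hom_comp[OF _ module_hom_comp[OF pure_tensor_hom(2)[OF X X]
    pure_tensor_hom(2)[OF V V zw]]]
  note Tx = T_closed[OF c(1,4,7)] and Ty = T_closed[OF c(2,5,8)]
  show "(\<lambda>x. yb_term x y z1 z2 z3 w1 w2 w3) \<in> module_hom K X (tensor K V V)"
    by (rule left[OF T_hom(1)[OF c(4,7)] Ty])
  show "(\<lambda>z2. yb_term x y z1 z2 z3 w1 w2 w3) \<in> module_hom K X (tensor K V V)"
    by (rule left[OF T_hom(2)[OF c(1,7)] Ty])
  show "(\<lambda>w2. yb_term x y z1 z2 z3 w1 w2 w3) \<in> module_hom K X (tensor K V V)"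
    by (rule left[OF T_hom(3)[OF c(1,4)] Ty])
  show "(\<lambda>y. yb_term x y z1 z2 z3 w1 w2 w3) \<in> module_hom K X (tensor K V V)"
    by (rule right[OF T_hom(1)[OF c(5,8)] Tx])
  show "(\<lambda>z3. yb_term x y z1 z2 z3 w1 w2 w3) \<in> module_hom K X (tensor K V V)"
    by (rule right[OF T_hom(2)[OF c(2,8)] Tx])
  show "(\<lambda>w3. yb_term x y z1 z2 z3 w1 w2 w3) \<in> module_hom K X (tensor K V V)"
    by (rule right[OF T_hom(3)[OF c(2,5)] Tx])
  show "(\<lambda>z1. yb_term x y z1 z2 z3 w1 w2 w3) \<in> module_hom K X (tensor K V V)"
    by (rule module_hom_comp[OF pure_tensor_hom(1)[OF X X c(6)] pure_tensor_hom(1)[OF V V TT]])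
  show "(\<lambda>w1. yb_term x y z1 z2 z3 w1 w2 w3) \<in> module_hom K X (tensor K V V)"
    by (rule module_hom_comp[OF pure_tensor_hom(2)[OF X X c(3)] pure_tensor_hom(1)[OF V V TT]])
qed

lemma yb_term_trilinear:
  assumes "x \<in> carrier X" "y \<in> carrier X" "z1 \<in> carrier X" "z2 \<in> carrier X" "z3 \<in> carrier X"
  shows "trilinear_map K X X X (tensor K V V) (yb_term x y z1 z2 z3)"
  by (rule trilinear_mapI) (intro yb_term_hom assms; assumption)+

lemma yb_sweedler_trilinear:
  assumes "x \<in> carrier X" "y \<in> carrier X" "w \<in> carrier X"
  shows "trilinear_map K X X X (tensor K V V)
    (\<lambda>z1 z2 z3. sweedler3 K L (tensor K V V) w (yb_term x y z1 z2 z3))"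
  by (rule trilinear_mapI; rule sweedler3_param[OF VV_module lie_ext_module _ _ assms(3)];
      (rule yb_term_trilinear yb_term_hom assms)+; (assumption | rule assms)+)

lemma yb_expr_hom:
  assumes c: "x \<in> carrier X" "y \<in> carrier X" "z \<in> carrier X" "w \<in> carrier X"
  shows "(\<lambda>x. yb_expr x y z w) \<in> module_hom K X (tensor K V V)"
    and "(\<lambda>y. yb_expr x y z w) \<in> module_hom K X (tensor K V V)"
    and "(\<lambda>z. yb_expr x y z w) \<in> module_hom K X (tensor K V V)"
    and "(\<lambda>w. yb_expr x y z w) \<in> module_hom K X (tensor K V V)"
proof -
  note P = sweedler3_param[OF VV_module lie_ext_module]
  show "(\<lambda>x. yb_expr x y z w) \<in> module_hom K X (tensor K V V)"
    using c by (intro P yb_sweedler_trilinear yb_term_trilinear yb_term_hom)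
  show "(\<lambda>y. yb_expr x y z w) \<in> module_hom K X (tensor K V V)"
    using c by (intro P yb_sweedler_trilinear yb_term_trilinear yb_term_hom)
  show "(\<lambda>z. yb_expr x y z w) \<in> module_hom K X (tensor K V V)"
    using c by (intro sweedler3_hom VV_module yb_sweedler_trilinear)
  show "(\<lambda>w. yb_expr x y z w) \<in> module_hom K X (tensor K V V)"
    using c by (intro P yb_sweedler_trilinear sweedler3_hom VV_module yb_term_trilinear)
qed

lemma lie_yb_map_hom: "lie_yb_map K L br \<in> module_hom K (tensor K V V) (tensor K V V)"
  unfolding lie_yb_map_def Let_def
  by (intro tensor_lift22_hom lie_ext_module VV_module)
    (simp_all add: bilinear_map_def yb_expr_hom)

lemma lie_yb_map_pure:
  assumes "x \<in> carrier X" "y \<in> carrier X" "z \<in> carrier X" "w \<in> carrier X"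
  shows "lie_yb_map K L br
      (pure_tensor K V V (pure_tensor K X X x y) (pure_tensor K X X z w)) = yb_expr x y z w"
  unfolding lie_yb_map_def Let_def
  by (rule tensor_lift22_pure[OF lie_ext_module lie_ext_module lie_ext_module lie_ext_module
        VV_module _ _ assms])
    (simp_all add: bilinear_map_def yb_expr_hom)

end

end

(*
  Write e = (1, 0) and let D_{z,w} send (a, x) to (0, [x, z', w']), where z' and w' are the
  L-components of z and w. Evaluating the Sweedler sums leaves only
    R(u (x) v) = v (x) u + (e (x) e) (x) (u . v),
  where (x (x) y) . (z (x) w) = D_{z,w} x (x) y + x (x) D_{z,w} y. The fundamental identity makes
  V = X (x) X a right Leibniz algebra under this product, and e (x) e multiplies to zero on both
  sides. For any such algebra, R has the inverse u (x) v |-> v (x) u - (v . u) (x) (e (x) e), and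
  the two sides of the braid equation differ only by the Leibniz identity
    (u . v) . w = (u . w) . v + u . (v . w).
*)

theory Submission
  imports Defs
begin

section \<open>Linear maps on tensor products\<close>

lemma module_hom_zero:
  assumes "module K M" "module K N" "f \<in> module_hom K M N"
  shows "f \<zero>\<^bsub>M\<^esub> = \<zero>\<^bsub>N\<^esub>"
proof -
  interpret mod_hom K M N f
    using assms by (auto simp: mod_hom_def mod_hom_axioms_def)
  show ?thesis by simp
qed

text \<open>Serves as the second map in \<open>tensor_hom_eq\<close> when a linear map on a tensor
  product is shown to vanish.\<close>

lemma module_hom_const_zero:
  assumes "module K M" "module K N"
  shows "(\<lambda>_. \<zero>\<^bsub>N\<^esub>) \<in> module_hom K M N"
proof -
  interpret N: module K N by fact
  show ?thesis by (simp add: module_hom_def)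
qed

text \<open>Instances for pure tensors and for products serve as expansion rules for
  \<open>simp\<close>.\<close>

lemma bilinear_map_simps:
  assumes "module K M" "module K N" "module K P" "bilinear_map K M N P b"
  shows "x \<in> carrier M \<Longrightarrow> y \<in> carrier N \<Longrightarrow> b x y \<in> carrier P"
    and "x \<in> carrier M \<Longrightarrow> x' \<in> carrier M \<Longrightarrow> y \<in> carrier N \<Longrightarrow>
      b (x \<oplus>\<^bsub>M\<^esub> x') y = b x y \<oplus>\<^bsub>P\<^esub> b x' y"
    and "x \<in> carrier M \<Longrightarrow> y \<in> carrier N \<Longrightarrow> y' \<in> carrier N \<Longrightarrow>
      b x (y \<oplus>\<^bsub>N\<^esub> y') = b x y \<oplus>\<^bsub>P\<^esub> b x y'"
    and "y \<in> carrier N \<Longrightarrow> b \<zero>\<^bsub>M\<^esub> y = \<zero>\<^bsub>P\<^esub>"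
    and "x \<in> carrier M \<Longrightarrow> b x \<zero>\<^bsub>N\<^esub> = \<zero>\<^bsub>P\<^esub>"
proof -
  have l: "(\<lambda>x. b x y) \<in> module_hom K M P" if "y \<in> carrier N" for y
    using assms(4) that by (simp add: bilinear_map_def)
  have r: "b x \<in> module_hom K N P" if "x \<in> carrier M" for x
    using assms(4) that by (simp add: bilinear_map_def)
  show "x \<in> carrier M \<Longrightarrow> y \<in> carrier N \<Longrightarrow> b x y \<in> carrier P"
    using r by (auto simp: module_hom_def Pi_iff)
  show "x \<in> carrier M \<Longrightarrow> x' \<in> carrier M \<Longrightarrow> y \<in> carrier N \<Longrightarrow>
      b (x \<oplus>\<^bsub>M\<^esub> x') y = b x y \<oplus>\<^bsub>P\<^esub> b x' y"
    using l by (auto simp: module_hom_def)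
  show "x \<in> carrier M \<Longrightarrow> y \<in> carrier N \<Longrightarrow> y' \<in> carrier N \<Longrightarrow>
      b x (y \<oplus>\<^bsub>N\<^esub> y') = b x y \<oplus>\<^bsub>P\<^esub> b x y'"
    using r by (auto simp: module_hom_def)
  show "y \<in> carrier N \<Longrightarrow> b \<zero>\<^bsub>M\<^esub> y = \<zero>\<^bsub>P\<^esub>"
    using module_hom_zero[OF assms(1,3) l] by simp
  show "x \<in> carrier M \<Longrightarrow> b x \<zero>\<^bsub>N\<^esub> = \<zero>\<^bsub>P\<^esub>"
    using module_hom_zero[OF assms(2,3) r] by simp
qed

section \<open>Uniqueness of linear maps from their values on generators\<close>

text \<open>Induction on a finite set \<open>A\<close> containing the support: an element of the
  free module is its coordinate at \<open>a\<close> times a generator plus an element supported on a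
  smaller set.\<close>

lemma free_module_hom_eq:
  assumes K: "cring K" and P: "module K P"
    and f: "f \<in> module_hom K (free_module K S) P" and g: "g \<in> module_hom K (free_module K S) P"
    and gen: "\<And>s. s \<in> S \<Longrightarrow> f (free_gen K S s) = g (free_gen K S s)"
    and \<phi>: "\<phi> \<in> carrier (free_module K S)"
  shows "f \<phi> = g \<phi>"
proof -
  interpret K: cring K by (rule K)
  let ?F = "free_module K S"
  have Fm: "module K ?F" by (rule free_module_module[OF K])
  interpret F: module K ?F by (rule Fm)
  interpret P: module K P by (rule P)
  note sel = free_module_sel[OF K, of S]
  have "\<forall>\<phi>\<in>carrier ?F. {s \<in> S. \<phi> s \<noteq> \<zero>\<^bsub>K\<^esub>} \<subseteq> A \<longrightarrow> f \<phi> = g \<phi>" if "finite A" for A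
    using that
  proof (induction A)
    case empty
    have "\<phi> = \<zero>\<^bsub>?F\<^esub>" if "\<phi> \<in> carrier ?F" "{s \<in> S. \<phi> s \<noteq> \<zero>\<^bsub>K\<^esub>} \<subseteq> {}" for \<phi>
      using that by (auto simp: sel PiE_def extensional_def)
    then show ?case
      using module_hom_zero[OF Fm P f] module_hom_zero[OF Fm P g] by auto
  next
    case (insert a A)
    show ?case
    proof (intro ballI impI)
      fix \<phi> assume \<phi>: "\<phi> \<in> carrier ?F" and sub: "{s \<in> S. \<phi> s \<noteq> \<zero>\<^bsub>K\<^esub>} \<subseteq> insert a A"
      show "f \<phi> = g \<phi>"
      proof (cases "a \<in> S")
        \<comment> \<open>The support consists of points of \<open>S\<close> only, so here it
          already lies in \<open>A\<close>.\<close>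
        case False
        then show ?thesis using insert.IH \<phi> sub by blast
      next
        case True
        \<comment> \<open>This is \<open>\<phi>\<close> with its coordinate at \<open>a\<close>
          erased.\<close>
        let ?\<psi> = "\<lambda>s\<in>S. if s = a then \<zero>\<^bsub>K\<^esub> else \<phi> s"
        have "finite {s \<in> S. \<phi> s \<noteq> \<zero>\<^bsub>K\<^esub>}" using \<phi> by (simp add: sel)
        then have "finite {s \<in> S. ?\<psi> s \<noteq> \<zero>\<^bsub>K\<^esub>}" by (rule rev_finite_subset) auto
        then have \<psi>: "?\<psi> \<in> carrier ?F" using \<phi> by (auto simp: sel)
        have "{s \<in> S. ?\<psi> s \<noteq> \<zero>\<^bsub>K\<^esub>} \<subseteq> A" using sub by auto
        then have eq: "f ?\<psi> = g ?\<psi>" using insert.IH \<psi> by blast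
        have a: "\<phi> a \<in> carrier K" using \<phi> True by (auto simp: sel)
        have gc: "free_gen K S a \<in> carrier ?F" by (rule free_gen_closed[OF K])
        have "\<phi> s \<in> carrier K" if "s \<in> S" for s using \<phi> that by (auto simp: sel)
        then have dec: "\<phi> = (\<phi> a \<odot>\<^bsub>?F\<^esub> free_gen K S a) \<oplus>\<^bsub>?F\<^esub> ?\<psi>"
          using \<phi> a by (intro ext) (auto simp: sel free_gen_def PiE_def extensional_def)
        have split: "h \<phi> = \<phi> a \<odot>\<^bsub>P\<^esub> h (free_gen K S a) \<oplus>\<^bsub>P\<^esub> h ?\<psi>" if "h \<in> module_hom K ?F P" for h
          by (subst dec)
            (simp only: module_hom_add[OF that F.smult_closed[OF a gc] \<psi>]
              module_hom_smult[OF that a gc])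
        show ?thesis by (simp only: split[OF f] split[OF g] gen[OF True] eq)
      qed
    qed
  qed
  then show ?thesis using \<phi> by (auto simp: sel)
qed

text \<open>Both maps pull back along the quotient map to the free module, whose generators go to
  the pure tensors.\<close>

lemma tensor_hom_eq:
  assumes M: "module K M" and N: "module K N" and P: "module K P"
    and f: "f \<in> module_hom K (tensor K M N) P" and g: "g \<in> module_hom K (tensor K M N) P"
    and pure: "\<And>x y. x \<in> carrier M \<Longrightarrow> y \<in> carrier N \<Longrightarrow>
      f (pure_tensor K M N x y) = g (pure_tensor K M N x y)"
    and t: "t \<in> carrier (tensor K M N)"
  shows "f t = g t"
proof -
  interpret M: module K M by (rule M)
  let ?q = "\<lambda>\<phi>. tensor_null K M N +>\<^bsub>tensor_free K M N\<^esub> \<phi>"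
  note q = quotient_module_module[OF tensor_null_submodule[OF M N], folded tensor_def]
  have q_hom: "?q \<in> module_hom K (tensor_free K M N) (tensor K M N)"
    using q by (auto simp: module_hom_def)
  obtain \<phi> where \<phi>: "\<phi> \<in> carrier (tensor_free K M N)" "t = ?q \<phi>"
    using t by (auto simp: tensor_def quotient_module_def A_RCOSETS_def')
  have "f (?q \<phi>) = g (?q \<phi>)"
    by (rule free_module_hom_eq[OF M.is_cring P module_hom_comp[OF q_hom f]
          module_hom_comp[OF q_hom g] _ \<phi>(1)])
      (use pure in \<open>auto simp: pure_tensor_def\<close>)
  then show ?thesis using \<phi>(2) by simp
qed

text \<open>Two uses of \<open>tensor_hom_eq\<close>: the outer one reduces to
  \<open>u (x) z\<close>, which for fixed \<open>z\<close> is linear in \<open>u\<close>, so the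
  inner one reduces \<open>u\<close> to a pure tensor.\<close>

lemma tensor_hom_eq3:
  assumes A: "module K A" and B: "module K B" and C: "module K C" and P: "module K P"
    and f: "f \<in> module_hom K (tensor K (tensor K A B) C) P"
    and g: "g \<in> module_hom K (tensor K (tensor K A B) C) P"
    and pure: "\<And>x y z. x \<in> carrier A \<Longrightarrow> y \<in> carrier B \<Longrightarrow> z \<in> carrier C \<Longrightarrow>
      f (pure_tensor K (tensor K A B) C (pure_tensor K A B x y) z) =
      g (pure_tensor K (tensor K A B) C (pure_tensor K A B x y) z)"
    and t: "t \<in> carrier (tensor K (tensor K A B) C)"
  shows "f t = g t"
proof (rule tensor_hom_eq[OF tensor_module[OF A B] C P f g _ t])
  fix u z assume u: "u \<in> carrier (tensor K A B)" and z: "z \<in> carrier C"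
  note h = pure_tensor_hom(1)[OF tensor_module[OF A B] C z]
  show "f (pure_tensor K (tensor K A B) C u z) = g (pure_tensor K (tensor K A B) C u z)"
    by (rule tensor_hom_eq[OF A B P module_hom_comp[OF h f] module_hom_comp[OF h g] pure u])
      (simp_all add: z)
qed

section \<open>Associativity isomorphisms on pure tensors\<close>

lemma
  assumes A: "module K A" and B: "module K B" and C: "module K C"
  shows tensor_assoc_hom: "tensor_assoc K A B C \<in>
      module_hom K (tensor K (tensor K A B) C) (tensor K A (tensor K B C))"
    and tensor_assoc_pure: "\<And>x y z. x \<in> carrier A \<Longrightarrow> y \<in> carrier B \<Longrightarrow> z \<in> carrier C \<Longrightarrow>
      tensor_assoc K A B C (pure_tensor K (tensor K A B) C (pure_tensor K A B x y) z) =
      pure_tensor K A (tensor K B C) x (pure_tensor K B C y z)"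
proof -
  note AB = tensor_module[OF A B] and BC = tensor_module[OF B C]
  note ABC = tensor_module[OF A BC]
  let ?b = "\<lambda>z x y. pure_tensor K A (tensor K B C) x (pure_tensor K B C y z)"
  have x: "(\<lambda>x. ?b z x y) \<in> module_hom K A (tensor K A (tensor K B C))"
    if "y \<in> carrier B" "z \<in> carrier C" for y z
    using that by (intro pure_tensor_hom(1)[OF A BC] pure_tensor_closed B C)
  have y: "(\<lambda>y. ?b z x y) \<in> module_hom K B (tensor K A (tensor K B C))"
    if "x \<in> carrier A" "z \<in> carrier C" for x z
    using module_hom_comp[OF pure_tensor_hom(1)[OF B C that(2)] pure_tensor_hom(2)[OF A BC that(1)]] .
  have z: "(\<lambda>z. ?b z x y) \<in> module_hom K C (tensor K A (tensor K B C))"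
    if "x \<in> carrier A" "y \<in> carrier B" for x y
    using module_hom_comp[OF pure_tensor_hom(2)[OF B C that(2)] pure_tensor_hom(2)[OF A BC that(1)]] .
  have b: "bilinear_map K A B (tensor K A (tensor K B C)) (?b z)" if "z \<in> carrier C" for z
    using x y that by (simp add: bilinear_map_def)
  have bil: "bilinear_map K (tensor K A B) C (tensor K A (tensor K B C))
      (\<lambda>t z. tensor_lift K A B (tensor K A (tensor K B C)) (?b z) t)"
    unfolding bilinear_map_def
  proof (intro conjI ballI)
    fix z assume "z \<in> carrier C"
    then show "(\<lambda>t. tensor_lift K A B (tensor K A (tensor K B C)) (?b z) t) \<in>
        module_hom K (tensor K A B) (tensor K A (tensor K B C))"
      using tensor_lift_hom[OF A B ABC b] by simp
  next
    \<comment> \<open>Linearity in \<open>z\<close> is required for every \<open>t\<close>, not only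
      for pure tensors; \<open>tensor_lift_param\<close> carries it over from the values
      \<open>?b z x y\<close> to the lift.\<close>
    fix t assume t: "t \<in> carrier (tensor K A B)"
    show "(\<lambda>z. tensor_lift K A B (tensor K A (tensor K B C)) (?b z) t) \<in>
        module_hom K C (tensor K A (tensor K B C))"
      by (rule tensor_lift_param[OF A B ABC C b z t])
  qed
  show "tensor_assoc K A B C \<in>
      module_hom K (tensor K (tensor K A B) C) (tensor K A (tensor K B C))"
    unfolding tensor_assoc_def by (rule tensor_lift_hom[OF AB C ABC bil])
  show "tensor_assoc K A B C (pure_tensor K (tensor K A B) C (pure_tensor K A B x y) z) =
      pure_tensor K A (tensor K B C) x (pure_tensor K B C y z)"
    if "x \<in> carrier A" "y \<in> carrier B" "z \<in> carrier C" for x y z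
    unfolding tensor_assoc_def
    using tensor_lift_pure[OF AB C ABC bil pure_tensor_closed[OF A B that(1,2)] that(3)]
      tensor_lift_pure[OF A B ABC b[OF that(3)] that(1,2)]
    by simp
qed

lemma
  assumes A: "module K A" and B: "module K B" and C: "module K C"
  shows tensor_assoc_inv_hom: "tensor_assoc_inv K A B C \<in>
      module_hom K (tensor K A (tensor K B C)) (tensor K (tensor K A B) C)"
    and tensor_assoc_inv_pure: "\<And>x y z. x \<in> carrier A \<Longrightarrow> y \<in> carrier B \<Longrightarrow> z \<in> carrier C \<Longrightarrow>
      tensor_assoc_inv K A B C (pure_tensor K A (tensor K B C) x (pure_tensor K B C y z)) =
      pure_tensor K (tensor K A B) C (pure_tensor K A B x y) z"
proof -
  note AB = tensor_module[OF A B]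
  have tri: "trilinear_map K A B C (tensor K (tensor K A B) C)
      (\<lambda>x y z. pure_tensor K (tensor K A B) C (pure_tensor K A B x y) z)"
  proof (rule trilinear_mapI)
    fix y z assume "y \<in> carrier B" "z \<in> carrier C"
    then show "(\<lambda>x. pure_tensor K (tensor K A B) C (pure_tensor K A B x y) z) \<in>
        module_hom K A (tensor K (tensor K A B) C)"
      using module_hom_comp[OF pure_tensor_hom(1)[OF A B] pure_tensor_hom(1)[OF AB C]] by blast
  next
    fix x z assume "x \<in> carrier A" "z \<in> carrier C"
    then show "(\<lambda>y. pure_tensor K (tensor K A B) C (pure_tensor K A B x y) z) \<in>
        module_hom K B (tensor K (tensor K A B) C)"
      using module_hom_comp[OF pure_tensor_hom(2)[OF A B] pure_tensor_hom(1)[OF AB C]] by blast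
  next
    fix x y assume "x \<in> carrier A" "y \<in> carrier B"
    then show "(\<lambda>z. pure_tensor K (tensor K A B) C (pure_tensor K A B x y) z) \<in>
        module_hom K C (tensor K (tensor K A B) C)"
      by (intro pure_tensor_hom(2)[OF AB C] pure_tensor_closed A B)
  qed
  note ABC = tensor_module[OF AB C]
  show "tensor_assoc_inv K A B C \<in>
      module_hom K (tensor K A (tensor K B C)) (tensor K (tensor K A B) C)"
    unfolding tensor_assoc_inv_def by (rule tensor_lift3_hom[OF A B C ABC tri])
  show "tensor_assoc_inv K A B C (pure_tensor K A (tensor K B C) x (pure_tensor K B C y z)) =
      pure_tensor K (tensor K A B) C (pure_tensor K A B x y) z"
    if "x \<in> carrier A" "y \<in> carrier B" "z \<in> carrier C" for x y z
    unfolding tensor_assoc_inv_def by (rule tensor_lift3_pure[OF A B C ABC tri that])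
qed

section \<open>Yang-Baxter operators from Leibniz algebras\<close>

text \<open>All maps involved are linear, so both invertibility and the braid equation are checked
  on pure tensors, where \<open>R_pure\<close> computes \<open>R\<close>.\<close>

lemma leibniz_yang_baxter_operator:
  assumes K: "field K" and V: "module K V"
    and m: "bilinear_map K V V V m"
    and e: "e \<in> carrier V" "\<And>v. v \<in> carrier V \<Longrightarrow> m e v = \<zero>\<^bsub>V\<^esub>"
      "\<And>v. v \<in> carrier V \<Longrightarrow> m v e = \<zero>\<^bsub>V\<^esub>"
    and leibniz: "\<And>u v w. u \<in> carrier V \<Longrightarrow> v \<in> carrier V \<Longrightarrow> w \<in> carrier V \<Longrightarrow>
      m (m u v) w = m (m u w) v \<oplus>\<^bsub>V\<^esub> m u (m v w)"
    and R: "R \<in> module_hom K (tensor K V V) (tensor K V V)"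
    and R_pure: "\<And>u v. u \<in> carrier V \<Longrightarrow> v \<in> carrier V \<Longrightarrow>
      R (pure_tensor K V V u v) = pure_tensor K V V v u \<oplus>\<^bsub>tensor K V V\<^esub> pure_tensor K V V e (m u v)"
  shows "yang_baxter_operator K V R"
proof -
  let ?W = "tensor K V V" and ?p = "pure_tensor K V V"
  have W: "module K ?W" by (rule tensor_module[OF V V])
  interpret V: module K V by (rule V)
  interpret W: module K ?W by (rule W)
  let ?U = "tensor K ?W V"
  let ?q = "\<lambda>u v w. pure_tensor K ?W V (?p u v) w"
  have U: "module K ?U" by (rule tensor_module[OF W V])
  interpret U: module K ?U by (rule U)
  note mult = bilinear_map_simps[OF V V V m]
  note p = bilinear_map_simps[OF V V W pure_tensor_bilinear[OF V V]]
    and pW = bilinear_map_simps[OF W V U pure_tensor_bilinear[OF W V]]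
    and pV = bilinear_map_simps[OF V W tensor_module[OF V W] pure_tensor_bilinear[OF V W]]

  \<comment> \<open>The candidate inverse. The difference is written as a sum with a negated term,
    so that \<open>module_hom_sum\<close> and the linearity of negation give bilinearity.\<close>
  define S where "S = tensor_lift K V V ?W
    (\<lambda>u v. ?p v u \<oplus>\<^bsub>?W\<^esub> \<ominus>\<^bsub>?W\<^esub> ?p (m v u) e)"
  have neg: "(\<lambda>t. \<ominus>\<^bsub>?W\<^esub> t) \<in> module_hom K ?W ?W"
    by (auto simp: module_hom_def W.minus_add W.smult_r_minus)
  have m_hom: "(\<lambda>u. m u v) \<in> module_hom K V V" "m v \<in> module_hom K V V" if "v \<in> carrier V" for v
    using m that by (simp_all add: bilinear_map_def)
  have bS: "bilinear_map K V V ?W (\<lambda>u v. ?p v u \<oplus>\<^bsub>?W\<^esub> \<ominus>\<^bsub>?W\<^esub> ?p (m v u) e)"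
    unfolding bilinear_map_def
    using module_hom_comp[OF module_hom_comp[OF m_hom(1) pure_tensor_hom(1)[OF V V e(1)]] neg]
      module_hom_comp[OF module_hom_comp[OF m_hom(2) pure_tensor_hom(1)[OF V V e(1)]] neg]
    by (intro conjI ballI module_hom_sum[OF W] pure_tensor_hom[OF V V])
  have S: "S \<in> module_hom K ?W ?W"
    unfolding S_def by (rule tensor_lift_hom[OF V V W bS])
  have S_pure: "S (?p u v) = ?p v u \<oplus>\<^bsub>?W\<^esub> \<ominus>\<^bsub>?W\<^esub> ?p (m v u) e"
    if "u \<in> carrier V" "v \<in> carrier V" for u v
    unfolding S_def by (rule tensor_lift_pure[OF V V W bS that])
  have neg_apply: "f (\<ominus>\<^bsub>?W\<^esub> t) = \<ominus>\<^bsub>?W\<^esub> f t" if "f \<in> module_hom K ?W ?W" "t \<in> carrier ?W" for f t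
  proof -
    interpret f: mod_hom K ?W ?W f by (unfold_locales) (rule that)
    show ?thesis using that(2) by simp
  qed
  have id: "(\<lambda>t. t) \<in> module_hom K ?W ?W" by (simp add: module_hom_def)
  \<comment> \<open>On \<open>u (x) v\<close> the terms \<open>(u . v) (x) e\<close> cancel, and the
    leftover contains \<open>(u . v) . e = 0\<close>. The instance of \<open>module_hom_zero\<close>
    for \<open>neg\<close> supplies \<open>\<ominus> 0 = 0\<close>.\<close>
  have SR: "S (R t) = t" if "t \<in> carrier ?W" for t
    by (rule tensor_hom_eq[OF V V W module_hom_comp[OF R S] id _ that])
      (simp add: R_pure S_pure module_hom_add[OF S] mult p e W.a_assoc W.l_neg
        module_hom_zero[OF W W neg])
  \<comment> \<open>Here the terms \<open>e (x) (v . u)\<close> cancel, and the leftover contains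
    \<open>(v . u) . e = 0\<close>.\<close>
  have RS: "R (S t) = t" if "t \<in> carrier ?W" for t
    by (rule tensor_hom_eq[OF V V W module_hom_comp[OF S R] id _ that])
      (simp add: R_pure S_pure module_hom_add[OF R] neg_apply[OF R] mult p e W.a_assoc W.r_neg
        module_hom_zero[OF W W neg])
  have bij: "bij_betw R (carrier ?W) (carrier ?W)"
    by (rule bij_betwI[where g = S]) (use R S SR RS in \<open>auto simp: module_hom_def\<close>)

  have idV: "id \<in> module_hom K V V" by (simp add: module_hom_def)
  have left: "yb_left K V R \<in> module_hom K ?U ?U"
    unfolding yb_left_def by (rule tensor_map_hom[OF W V W V R idV])
  have right: "yb_right K V R \<in> module_hom K ?U ?U"
    unfolding yb_right_def comp_def
    by (rule module_hom_comp[OF module_hom_comp[OF tensor_assoc_hom[OF V V V]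
          tensor_map_hom[OF V W V W idV R]] tensor_assoc_inv_hom[OF V V V]])
  have q: "?q u v w \<in> carrier ?U" if "u \<in> carrier V" "v \<in> carrier V" "w \<in> carrier V" for u v w
    using that by (simp add: p pW)
  have left_pure: "yb_left K V R (?q u v w) = ?q v u w \<oplus>\<^bsub>?U\<^esub> ?q e (m u v) w"
    if "u \<in> carrier V" "v \<in> carrier V" "w \<in> carrier V" for u v w
    using that
    by (simp add: yb_left_def tensor_map_pure[OF W V W V R idV] R_pure p pW e mult)
  have right_pure: "yb_right K V R (?q u v w) = ?q u w v \<oplus>\<^bsub>?U\<^esub> ?q u e (m v w)"
    if "u \<in> carrier V" "v \<in> carrier V" "w \<in> carrier V" for u v w
    using that
    by (simp add: yb_right_def tensor_assoc_pure[OF V V V] tensor_map_pure[OF V W V W idV R]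
        R_pure p pV e mult module_hom_add[OF tensor_assoc_inv_hom[OF V V V]]
        tensor_assoc_inv_pure[OF V V V])
  have braid: "yb_left K V R (yb_right K V R (yb_left K V R t)) =
      yb_right K V R (yb_left K V R (yb_right K V R t))" if "t \<in> carrier ?U" for t
  proof (rule tensor_hom_eq3[OF V V V U module_hom_comp[OF module_hom_comp[OF left right] left]
        module_hom_comp[OF module_hom_comp[OF right left] right] _ that])
    fix u v w assume c: "u \<in> carrier V" "v \<in> carrier V" "w \<in> carrier V"
    show "yb_left K V R (yb_right K V R (yb_left K V R (?q u v w))) =
        yb_right K V R (yb_left K V R (yb_right K V R (?q u v w)))"
      \<comment> \<open>Products with \<open>e\<close> vanish. Both sides then share
        \<open>w (x) v (x) u\<close>, \<open>e (x) (v . w) (x) u\<close>,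
        \<open>e (x) v (x) (u . w)\<close> and \<open>w (x) e (x) (u . v)\<close>. What remains is
        \<open>e (x) e (x) ((u . v) . w)\<close> on the left and
        \<open>e (x) e (x) ((u . w) . v) + e (x) e (x) (u . (v . w))\<close> on the right.\<close>
      using c by (simp add: left_pure right_pure module_hom_add[OF left] module_hom_add[OF right]
          q mult e p pW leibniz[of u v w] U.a_ac)
  qed
  \<comment> \<open>\<open>linear_map\<close> speaks of vector spaces, so the module structures are
    combined with the field.\<close>
  interpret field K by (rule K)
  have "linear_map K ?W ?W R"
    by (unfold_locales) (rule R)
  then show ?thesis
    unfolding yang_baxter_operator_def using bij braid by blast
qed

section \<open>The Leibniz algebra on the tensor square of the extended 3-Lie algebra\<close>

context three_Lie_algebra
begin

section \<open>The operators D_{z,w} on \<open>X\<close>\<close>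

abbreviation (input) "unit_elem \<equiv> (\<one>\<^bsub>K\<^esub>, \<zero>\<^bsub>L\<^esub>)"

text \<open>This is D_{z,w}. The acting pair comes first, so that \<open>der z w\<close> is an
  endomorphism of \<open>X\<close>.\<close>

definition der :: "'k \<times> 'l \<Rightarrow> 'k \<times> 'l \<Rightarrow> 'k \<times> 'l \<Rightarrow> 'k \<times> 'l" where
  "der z w x = (\<zero>\<^bsub>K\<^esub>, br (snd x) (snd z) (snd w))"

lemma der_hom:
  "\<lbrakk>z \<in> carrier X; w \<in> carrier X\<rbrakk> \<Longrightarrow> der z w \<in> module_hom K X X"
  "\<lbrakk>x \<in> carrier X; w \<in> carrier X\<rbrakk> \<Longrightarrow> (\<lambda>z. der z w x) \<in> module_hom K X X"
  "\<lbrakk>x \<in> carrier X; z \<in> carrier X\<rbrakk> \<Longrightarrow> (\<lambda>w. der z w x) \<in> module_hom K X X"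
  by (auto simp: module_hom_def lie_ext_sel der_def br_hom)

lemma der_closed:
  "\<lbrakk>z \<in> carrier X; w \<in> carrier X; x \<in> carrier X\<rbrakk> \<Longrightarrow> der z w x \<in> carrier X"
  by (auto simp: der_def lie_ext_sel br_hom)

lemma unit_elem_closed: "unit_elem \<in> carrier X"
  by (simp add: lie_ext_sel)

lemma lie_ext_zero_closed: "\<zero>\<^bsub>X\<^esub> \<in> carrier X"
  by (simp add: lie_ext_sel)

lemma br_zero:
  assumes "x \<in> carrier L" "y \<in> carrier L"
  shows "br \<zero>\<^bsub>L\<^esub> x y = \<zero>\<^bsub>L\<^esub>" "br x \<zero>\<^bsub>L\<^esub> y = \<zero>\<^bsub>L\<^esub>" "br x y \<zero>\<^bsub>L\<^esub> = \<zero>\<^bsub>L\<^esub>"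
  using module_hom_zero[OF module_axioms module_axioms linear1[OF assms]]
    module_hom_zero[OF module_axioms module_axioms linear2[OF assms]]
    module_hom_zero[OF module_axioms module_axioms linear3[OF assms]] .

text \<open>The L-component of \<open>unit_elem\<close> is zero, and the bracket vanishes as soon as
  one of its entries does.\<close>

lemma der_unit:
  assumes "z \<in> carrier X" "w \<in> carrier X"
  shows "der unit_elem z w = \<zero>\<^bsub>X\<^esub>" "der z unit_elem w = \<zero>\<^bsub>X\<^esub>" "der z w unit_elem = \<zero>\<^bsub>X\<^esub>"
  using assms by (auto simp: der_def lie_ext_sel br_zero)

text \<open>The fundamental identity, read as a commutator formula: [D_{r,s}, D_{p,q}] = D_{D_{r,s}
  p, q} + D_{p, D_{r,s} q}. All scalar parts are zero.\<close>

lemma der_der: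
  assumes "p \<in> carrier X" "q \<in> carrier X" "r \<in> carrier X" "s \<in> carrier X" "x \<in> carrier X"
  shows "der r s (der p q x) =
    der p q (der r s x) \<oplus>\<^bsub>X\<^esub> (der (der r s p) q x \<oplus>\<^bsub>X\<^esub> der p (der r s q) x)"
  using assms fundamental[of "snd x" "snd p" "snd q" "snd r" "snd s"]
  by (auto simp: der_def lie_ext_sel br_hom a_assoc)

section \<open>The Leibniz product on \<open>V\<close>\<close>

abbreviation (input) "der_term x y z w \<equiv>
  pure_tensor K X X (der z w x) y \<oplus>\<^bsub>V\<^esub> pure_tensor K X X x (der z w y)"

text \<open>In \<open>der_term\<close>, D_{z,w} acts on \<open>x (x) y\<close> by the product rule.
  Lifting to a linear map on \<open>V (x) V\<close> and composing with the pure tensor makes the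
  product bilinear on \<open>V\<close>.\<close>

definition leibniz_mult where
  "leibniz_mult u v = tensor_lift22 K X X X X V der_term (pure_tensor K V V u v)"

lemma
  shows leibniz_mult_bilinear: "bilinear_map K V V V leibniz_mult"
    and leibniz_mult_pure: "\<lbrakk>x \<in> carrier X; y \<in> carrier X; z \<in> carrier X; w \<in> carrier X\<rbrakk> \<Longrightarrow>
      leibniz_mult (pure_tensor K X X x y) (pure_tensor K X X z w) = der_term x y z w"
proof -
  note X = lie_ext_module and V = V_module
  have b1: "bilinear_map K X X V (\<lambda>x y. der_term x y z w)"
    if "z \<in> carrier X" "w \<in> carrier X" for z w
    unfolding bilinear_map_def
    using that module_hom_comp[OF der_hom(1)[OF that] pure_tensor_hom(1)[OF X X]]
      module_hom_comp[OF der_hom(1)[OF that] pure_tensor_hom(2)[OF X X]]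
    by (intro conjI ballI module_hom_sum V pure_tensor_hom[OF X X] der_closed) auto
  have b2: "bilinear_map K X X V (der_term x y)"
    if c: "x \<in> carrier X" "y \<in> carrier X" for x y
    unfolding bilinear_map_def
    using module_hom_comp[OF der_hom(2)[OF c(1)] pure_tensor_hom(1)[OF X X c(2)]]
      module_hom_comp[OF der_hom(2)[OF c(2)] pure_tensor_hom(2)[OF X X c(1)]]
      module_hom_comp[OF der_hom(3)[OF c(1)] pure_tensor_hom(1)[OF X X c(2)]]
      module_hom_comp[OF der_hom(3)[OF c(2)] pure_tensor_hom(2)[OF X X c(1)]]
    by (intro conjI ballI module_hom_sum V)
  note hom = tensor_lift22_hom[OF X X X X V b1 b2]
  show "bilinear_map K V V V leibniz_mult"
    unfolding bilinear_map_def leibniz_mult_def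
    using module_hom_comp[OF pure_tensor_hom(1)[OF V V] hom]
      module_hom_comp[OF pure_tensor_hom(2)[OF V V] hom] by blast
  show "leibniz_mult (pure_tensor K X X x y) (pure_tensor K X X z w) = der_term x y z w"
    if "x \<in> carrier X" "y \<in> carrier X" "z \<in> carrier X" "w \<in> carrier X"
    unfolding leibniz_mult_def by (rule tensor_lift22_pure[OF X X X X V b1 b2 that])
qed

lemma leibniz_mult_hom:
  "v \<in> carrier V \<Longrightarrow> (\<lambda>u. leibniz_mult u v) \<in> module_hom K V V"
  "u \<in> carrier V \<Longrightarrow> leibniz_mult u \<in> module_hom K V V"
  using leibniz_mult_bilinear by (simp_all add: bilinear_map_def)

lemmas pure_tensor_simps =
  bilinear_map_simps[OF lie_ext_module lie_ext_module V_module
    pure_tensor_bilinear[OF lie_ext_module lie_ext_module]]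

lemmas leibniz_mult_simps =
  bilinear_map_simps[OF V_module V_module V_module leibniz_mult_bilinear]

abbreviation (input) "unit_tensor \<equiv> pure_tensor K X X unit_elem unit_elem"

lemma unit_tensor_closed: "unit_tensor \<in> carrier V"
  by (intro pure_tensor_simps unit_elem_closed)

text \<open>By linearity in \<open>v\<close> it suffices to take \<open>v\<close> pure, and there
  \<open>der_unit\<close> kills every summand.\<close>

lemma leibniz_mult_unit:
  assumes "v \<in> carrier V"
  shows "leibniz_mult unit_tensor v = \<zero>\<^bsub>V\<^esub>" "leibniz_mult v unit_tensor = \<zero>\<^bsub>V\<^esub>"
proof -
  interpret V: module K V by (rule V_module)
  note ext = tensor_hom_eq[OF lie_ext_module lie_ext_module V_module _
      module_hom_const_zero[OF V_module V_module] _ assms]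
  show "leibniz_mult unit_tensor v = \<zero>\<^bsub>V\<^esub>"
    by (rule ext[OF leibniz_mult_hom(2)[OF unit_tensor_closed]])
      (simp add: leibniz_mult_pure unit_elem_closed der_unit pure_tensor_simps)
  show "leibniz_mult v unit_tensor = \<zero>\<^bsub>V\<^esub>"
    by (rule ext[OF leibniz_mult_hom(1)[OF unit_tensor_closed]])
      (simp add: leibniz_mult_pure unit_elem_closed der_unit pure_tensor_simps)
qed

text \<open>On pure tensors, the mixed terms \<open>D_{p,q} x (x) D_{r,s} y\<close> and
  \<open>D_{r,s} x (x) D_{p,q} y\<close> occur in both double products \<open>(u . v) . w\<close>
  and \<open>(u . w) . v\<close>. The other terms match by \<open>der_der\<close> in each tensor
  factor.\<close>

lemma leibniz_identity:
  assumes "u \<in> carrier V" "v \<in> carrier V" "w \<in> carrier V"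
  shows "leibniz_mult (leibniz_mult u v) w =
    leibniz_mult (leibniz_mult u w) v \<oplus>\<^bsub>V\<^esub> leibniz_mult u (leibniz_mult v w)"
proof -
  note X = lie_ext_module and V = V_module and m = leibniz_mult_hom and closed = leibniz_mult_simps(1)
  interpret X: module K X by (rule X)
  interpret V: module K V by (rule V)
  note ext = tensor_hom_eq[OF X X V]
  \<comment> \<open>Pure tensors are introduced by equations, so that the next fact can put
    \<open>refl\<close> in place of the argument it sets free.\<close>
  have 0: "leibniz_mult (leibniz_mult u v) w =
      leibniz_mult (leibniz_mult u w) v \<oplus>\<^bsub>V\<^esub> leibniz_mult u (leibniz_mult v w)"
    if "u = pure_tensor K X X x y" "v = pure_tensor K X X p q" "w = pure_tensor K X X r s"
      "x \<in> carrier X" "y \<in> carrier X" "p \<in> carrier X" "q \<in> carrier X" "r \<in> carrier X" "s \<in> carrier X"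
    for u v w x y p q r s
    using that(4-)
    by (simp add: that(1-3) leibniz_mult_pure leibniz_mult_simps pure_tensor_simps der_closed
        der_der[of p q r s] X.a_closed V.a_ac)
  \<comment> \<open>From here on \<open>w\<close>, then \<open>v\<close>, then \<open>u\<close> is
    freed; at each stage both sides are linear in that argument.\<close>
  have 1: "leibniz_mult (leibniz_mult u v) w =
      leibniz_mult (leibniz_mult u w) v \<oplus>\<^bsub>V\<^esub> leibniz_mult u (leibniz_mult v w)"
    if "u = pure_tensor K X X x y" "v = pure_tensor K X X p q" "w \<in> carrier V"
      "x \<in> carrier X" "y \<in> carrier X" "p \<in> carrier X" "q \<in> carrier X"
    for u v w x y p q
  proof -
    have c: "u \<in> carrier V" "v \<in> carrier V" using that by (simp_all add: pure_tensor_simps)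
    show ?thesis
      by (rule ext[OF m(2)[OF closed[OF c]] module_hom_sum[OF V
              module_hom_comp[OF m(2)[OF c(1)] m(1)[OF c(2)]]
              module_hom_comp[OF m(2)[OF c(2)] m(2)[OF c(1)]]] 0[OF that(1,2) refl that(4-7)]
            that(3)])
  qed
  have 2: "leibniz_mult (leibniz_mult u v) w =
      leibniz_mult (leibniz_mult u w) v \<oplus>\<^bsub>V\<^esub> leibniz_mult u (leibniz_mult v w)"
    if "u = pure_tensor K X X x y" "v \<in> carrier V" "w \<in> carrier V" "x \<in> carrier X" "y \<in> carrier X"
    for u v w x y
  proof -
    have c: "u \<in> carrier V" using that by (simp add: pure_tensor_simps)
    show ?thesis
      by (rule ext[OF module_hom_comp[OF m(2)[OF c] m(1)[OF that(3)]] module_hom_sum[OF V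
              m(2)[OF closed[OF c that(3)]]
              module_hom_comp[OF m(1)[OF that(3)] m(2)[OF c]]] 1[OF that(1) refl that(3-5)]
            that(2)])
  qed
  show ?thesis
    by (rule ext[OF module_hom_comp[OF m(1)[OF assms(2)] m(1)[OF assms(3)]] module_hom_sum[OF V
            module_hom_comp[OF m(1)[OF assms(3)] m(1)[OF assms(2)]]
            m(1)[OF closed[OF assms(2,3)]]] 2[OF refl assms(2,3)]
          assms(1)])
qed

section \<open>Sweedler sums and the values of R\<close>

lemma lie_comult_apply:
  "lie_comult K L (c, z) =
    pure_tensor K X X (c, z) unit_elem \<oplus>\<^bsub>V\<^esub> pure_tensor K X X unit_elem (\<zero>\<^bsub>K\<^esub>, z)"
  by (simp add: lie_comult_def Let_def)

text \<open>The unit \<open>e\<close> is group-like and (0, z) is primitive: \<open>\<Delta>\<close>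
  sends \<open>e\<close> to \<open>e (x) e\<close> and (0, z) to
  \<open>(0, z) (x) e + e (x) (0, z)\<close>. Applying this to the second factors of
  \<open>(c, z) (x) e + e (x) (0, z)\<close> gives the three terms.\<close>

lemma sweedler3_apply:
  assumes P: "module K P" and h: "trilinear_map K X X X P h" and z: "(c, z) \<in> carrier X"
  shows "sweedler3 K L P (c, z) h =
    h (c, z) unit_elem unit_elem \<oplus>\<^bsub>P\<^esub>
      (h unit_elem (\<zero>\<^bsub>K\<^esub>, z) unit_elem \<oplus>\<^bsub>P\<^esub> h unit_elem unit_elem (\<zero>\<^bsub>K\<^esub>, z))"
proof -
  note X = lie_ext_module and V = V_module
  interpret V: module K V by (rule V)
  interpret P: module K P by (rule P)
  interpret XV: module K "tensor K X V" by (rule XV_module)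
  have id: "id \<in> module_hom K X X" by (simp add: module_hom_def)
  note map = tensor_map_hom[OF X X X V id lie_comult_hom]
    and map_pure = tensor_map_pure[OF X X X V id lie_comult_hom]
    and lift = tensor_lift3_hom[OF X X X P h] and lift_pure = tensor_lift3_pure[OF X X X P h]
    and pXV = bilinear_map_simps[OF X V XV_module pure_tensor_bilinear[OF X V]]
  have z0: "(\<zero>\<^bsub>K\<^esub>, z) \<in> carrier X" using z by (simp add: lie_ext_sel)
  \<comment> \<open>Recognising the zero of \<open>X\<close> makes the second summand of the
    coproduct of \<open>unit_elem\<close> vanish.\<close>
  have e0: "(\<zero>\<^bsub>K\<^esub>, \<zero>\<^bsub>L\<^esub>) = \<zero>\<^bsub>X\<^esub>" by (simp add: lie_ext_sel)
  have comult_e: "lie_comult K L unit_elem = unit_tensor"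
    by (simp add: lie_comult_apply e0 pure_tensor_simps unit_elem_closed unit_tensor_closed)
  have comult_z: "lie_comult K L (\<zero>\<^bsub>K\<^esub>, z) =
      pure_tensor K X X (\<zero>\<^bsub>K\<^esub>, z) unit_elem \<oplus>\<^bsub>V\<^esub> pure_tensor K X X unit_elem (\<zero>\<^bsub>K\<^esub>, z)"
    by (rule lie_comult_apply)
  show ?thesis
    by (simp add: sweedler3_def Let_def lie_comult_apply[of c z] z z0 unit_elem_closed pure_tensor_simps
        module_hom_add[OF map] map_pure comult_e comult_z pXV module_hom_add[OF lift] lift_pure)
qed

lemma T_unit:
  assumes "x \<in> carrier X"
  shows "T x unit_elem unit_elem = x"
  using assms by (cases x) (simp add: lie_ternary_pure lie_ext_sel br_zero)

text \<open>The scalar product has a factor 0 and the bracket has a zero entry. This removes the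
  cross terms of the double Sweedler sum.\<close>

lemma T_zero:
  assumes "x \<in> carrier X" "z \<in> carrier L"
  shows "T x (\<zero>\<^bsub>K\<^esub>, z) unit_elem = \<zero>\<^bsub>X\<^esub>" "T x unit_elem (\<zero>\<^bsub>K\<^esub>, z) = \<zero>\<^bsub>X\<^esub>"
  using assms by (cases x; simp add: lie_ternary_pure lie_ext_sel br_zero)+

text \<open>Both scalar terms vanish, so only the bracket is left. The scalars \<open>c\<close> and
  \<open>d\<close> are free because \<open>der\<close> reads L-components only.\<close>

lemma T_der:
  assumes "x \<in> carrier X" "(c, z) \<in> carrier X" "(d, w) \<in> carrier X"
  shows "T x (\<zero>\<^bsub>K\<^esub>, z) (\<zero>\<^bsub>K\<^esub>, w) = der (c, z) (d, w) x"
  using assms by (cases x) (simp add: lie_ternary_pure lie_ext_sel der_def br_hom)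

text \<open>The double sum has nine terms, according to the slots holding \<open>z\<close> and
  \<open>w\<close>. Different slots leave a factor covered by \<open>T_zero\<close>, so only three
  terms survive. Slot 1 gives the flip by \<open>T_unit\<close>; slots 2 and 3 give the two halves
  of \<open>der_term\<close> by \<open>T_der\<close>.\<close>

lemma yb_expr_eq:
  assumes c: "x \<in> carrier X" "y \<in> carrier X" "z \<in> carrier X" "w \<in> carrier X"
  shows "yb_expr x y z w =
    pure_tensor K V V (pure_tensor K X X z w) (pure_tensor K X X x y) \<oplus>\<^bsub>tensor K V V\<^esub>
    pure_tensor K V V unit_tensor (der_term x y z w)"
proof -
  obtain a z' b w' where zw: "z = (a, z')" "w = (b, w')" by (cases z; cases w)
  note X = lie_ext_module and V = V_module and W = VV_module
  interpret V: module K V by (rule V)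
  interpret W: module K "tensor K V V" by (rule W)
  have z': "z' \<in> carrier L" "(\<zero>\<^bsub>K\<^esub>, z') \<in> carrier X" and w': "w' \<in> carrier L" "(\<zero>\<^bsub>K\<^esub>, w') \<in> carrier X"
    using c(3,4) zw by (simp_all add: lie_ext_sel)
  note pV = bilinear_map_simps[OF V V W pure_tensor_bilinear[OF V V]]
  have inner: "sweedler3 K L (tensor K V V) w (yb_term x y z1 z2 z3) =
      yb_term x y z1 z2 z3 w unit_elem unit_elem \<oplus>\<^bsub>tensor K V V\<^esub>
      (yb_term x y z1 z2 z3 unit_elem (\<zero>\<^bsub>K\<^esub>, w') unit_elem \<oplus>\<^bsub>tensor K V V\<^esub>
       yb_term x y z1 z2 z3 unit_elem unit_elem (\<zero>\<^bsub>K\<^esub>, w'))"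
    if "z1 \<in> carrier X" "z2 \<in> carrier X" "z3 \<in> carrier X" for z1 z2 z3
    using sweedler3_apply[OF W yb_term_trilinear[OF c(1,2) that] c(4)[unfolded zw]] zw(2) by simp
  have outer: "yb_expr x y z w =
      sweedler3 K L (tensor K V V) w (yb_term x y z unit_elem unit_elem) \<oplus>\<^bsub>tensor K V V\<^esub>
      (sweedler3 K L (tensor K V V) w (yb_term x y unit_elem (\<zero>\<^bsub>K\<^esub>, z') unit_elem) \<oplus>\<^bsub>tensor K V V\<^esub>
       sweedler3 K L (tensor K V V) w (yb_term x y unit_elem unit_elem (\<zero>\<^bsub>K\<^esub>, z')))"
    using sweedler3_apply[OF W yb_sweedler_trilinear[OF c(1,2,4)] c(3)[unfolded zw]] zw(1) by simp
  have der: "T t (\<zero>\<^bsub>K\<^esub>, z') (\<zero>\<^bsub>K\<^esub>, w') = der z w t" if "t \<in> carrier X" for t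
    using T_der[OF that] c(3,4) zw by simp
  show ?thesis
    unfolding outer
    by (simp add: inner c z' w' unit_elem_closed lie_ext_zero_closed T_unit T_zero der
        der_closed pure_tensor_simps pV)
qed

text \<open>Extends \<open>yb_expr_eq\<close> from pure \<open>u\<close> and \<open>v\<close> by
  linearity, first in \<open>v\<close> and then in \<open>u\<close>.\<close>

lemma lie_yb_map_eq:
  assumes "u \<in> carrier V" "v \<in> carrier V"
  shows "lie_yb_map K L br (pure_tensor K V V u v) =
    pure_tensor K V V v u \<oplus>\<^bsub>tensor K V V\<^esub> pure_tensor K V V unit_tensor (leibniz_mult u v)"
proof -
  note X = lie_ext_module and V = V_module and W = VV_module and R = lie_yb_map_hom
    and m = leibniz_mult_hom and e = unit_tensor_closed
  note ext = tensor_hom_eq[OF X X W]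
  have 0: "lie_yb_map K L br (pure_tensor K V V u v) =
      pure_tensor K V V v u \<oplus>\<^bsub>tensor K V V\<^esub> pure_tensor K V V unit_tensor (leibniz_mult u v)"
    if "u = pure_tensor K X X x y" "v \<in> carrier V" "x \<in> carrier X" "y \<in> carrier X" for u v x y
  proof -
    have u: "u \<in> carrier V" using that by (simp add: pure_tensor_simps)
    show ?thesis
      by (rule ext[OF module_hom_comp[OF pure_tensor_hom(2)[OF V V u] R] module_hom_sum[OF W
              pure_tensor_hom(1)[OF V V u]
              module_hom_comp[OF m(2)[OF u] pure_tensor_hom(2)[OF V V e]]] _ that(2)])
        (simp add: that lie_yb_map_pure yb_expr_eq leibniz_mult_pure)
  qed
  show ?thesis
    by (rule ext[OF module_hom_comp[OF pure_tensor_hom(1)[OF V V assms(2)] R] module_hom_sum[OF W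
            pure_tensor_hom(2)[OF V V assms(2)]
            module_hom_comp[OF m(1)[OF assms(2)] pure_tensor_hom(2)[OF V V e]]]
          0[OF refl assms(2)] assms(1)])
qed

end

theorem corollary4p2:
  fixes K :: "('k, 'm) ring_scheme" and L :: "('k, 'l, 'n) module_scheme"
    and br :: "'l \<Rightarrow> 'l \<Rightarrow> 'l \<Rightarrow> 'l"
  assumes "three_Lie_algebra K L br"
  shows "yang_baxter_operator K (tensor K (lie_ext K L) (lie_ext K L)) (lie_yb_map K L br)"
proof -
  interpret three_Lie_algebra K L br by (rule assms)
  show ?thesis
    by (rule leibniz_yang_baxter_operator[OF field_axioms V_module leibniz_mult_bilinear
          unit_tensor_closed leibniz_mult_unit leibniz_identity lie_yb_map_hom lie_yb_map_eq])
qed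

end
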